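(* In the setting described in the context (Snake model with $\beta\ge2$, $\ell=\beta-1$, estimator $\hat f$ based on arbitrary regression estimators with sup-norm error bounds $\Gamma,\Lambda$, and multivariate polynomial interpolation), let $L:=\beta!\,\sup_{k\in\{0,\dots,\beta\}}L_k^{\beta+1}$ and let $\delta\ge0$, potentially changing with $n$. Assume $T\prec n$, $\Gamma\prec1$, $\Gamma\prec\delta$, and $\Gamma\preccurlyeq\Lambda\preccurlyeq1$. (i) Set $\mathcal X:=\mathcal G_{\ell,\delta,s}(u^\star([0,T]))$. Then $$\sup_{x\in\mathcal X}\|\hat f(x)-f^\star(x)\|_2^2\in\mathbf O_{\mathbf P}\big(\delta^{2\beta}+\Lambda(n,\beta+1,L,T)^2\big).$$ (ii) Set $\delta:=\delta_{\mathsf{NN}}^{\ell,s}(u^\star,T,[0,1]^d)$. Then $$\sup_{x\in[0,1]^d}\|\hat f(x)-f^\star(x)\|_2^2\in\mathbf O_{\mathbf P}\big(\delta^{2\beta}+\Lambda(n,\beta+1,L,T)^2\big).$$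
   Context: Asymptotic notation (as $n\to\infty$): $a_n\preccurlyeq b_n$ means $\limsup a_n/b_n<\infty$; $a_n\prec b_n$ means $\limsup a_n/b_n=0$. $X_n\in\mathbf O_{\mathbf P}(a_n)$ means: for every $\epsilon>0$ there are $B>0$ and $n_0$ with $\mathbf P(|X_n/a_n|>B)<\epsilon$ for all $n\ge n_0$. The quantities $d,\beta,L_0,\dots,L_\beta,\sigma,s,D,\mu$ are fixed; all others may vary with $n$. Model: $d\ge2$, $\beta\ge2$ integers, $L_0,\dots,L_\beta>0$. $\mathcal F_{d,\beta}$ is the set of $\beta$-times continuously differentiable $f\colon\mathbb R^d\to\mathbb R^d$ with $\sup_x\|D^kf(x)\|_{\mathsf{op}}\le L_k$ for $k=0,\dots,\beta$ (operator norm of multilinear maps with respect to Euclidean norms, $D^0f=f$). $f^\star\in\mathcal F_{d,\beta}$, $x_1\in\mathbb R^d$, $n\in\mathbb N$, $T>0$, $0=t_0\le t_1\le\dots\le t_n=T$. $U(f,x,\cdot)$ denotes the solution $u$ of $\dot u=f(u)$, $u(0)=x$, and $u^\star:=U(f^\star,x_1,\cdot)$. Let $\sigma\ge0$, and let $\varepsilon_1,\dots,\varepsilon_n$ be independent, $\mathbb R^d$-valued, centered, $\mathbf E[\|\varepsilon_i\|_2^2]\le\sigma^2$. Observe $Y_i:=u^\star(t_i)+\varepsilon_i$, $i=1,\dots,n$. Regression estimators: for $L>0$ let $\Sigma^{1\to d}(\beta+1,L)$ be the set of $g=(g_1,\dots,g_d)\colon\mathbb R\to\mathbb R^d$ such that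 each $g_k$ is $\beta$-times differentiable with $|D^\beta g_k(t)-D^\beta g_k(t')|\le L|t-t'|$ for all $t,t'$. Let $\mathfrak P_n$ be the model of all laws of data $(t_i,Z_i)_{i=1}^n$ with $Z_i=g(t_i)+\xi_i$, $g\in\Sigma^{1\to d}(\beta+1,L)$, $\xi_i$ independent, centered, $\mathbf E[\|\xi_i\|_2^2]\le\sigma^2$. Let $\mathcal E,\widetilde{\mathcal E}$ be arbitrary (measurable) regression estimators of $g$ and of its derivative $\dot g$, i.e. maps of the data and a point $t$ into $\mathbb R^d$. Let $\Gamma=\Gamma(n,\beta+1,L,T)>0$ and $\Lambda=\Lambda(n,\beta+1,L,T)>0$ be sup-norm error bounds in probability for them: for all $\mathbf P\in\mathfrak P_n$, as $n\to\infty$, $\sup_{t\in[0,T]}\|\mathcal E((t_i,Z_i)_i,t)-g(t)\|_2\in\mathbf O_{\mathbf P}(\Gamma)$ and $\sup_{t\in[0,T]}\|\widetilde{\mathcal E}((t_i,Z_i)_i,t)-\dot g(t)\|_2\in\mathbf O_{\mathbf P}(\Lambda)$. Set $\hat u(t):=\mathcal E((t_i,Y_i)_i,t)$ and $\hat{\dot u}(t):=\widetilde{\mathcal E}((t_i,Y_i)_i,t)$. Polynomial interpolation: $\ell:=\beta-1$, $N:=\binom{\ell+d}{d}$, $\psi(x):=(x^\alpha)_{\alpha\in\mathbb N_0^d,|\alpha|\le\ell}\in\mathbb R^N$; for $\mathbf x=(x_1,\dots,x_N)\in(\mathbb R^d)^N$, $\Psi(\mathbf x):=(\psi(x_1),\dots,\psi(x_N))^\top\in\mathbb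 R^{N\times N}$; for $\mathbf y\in\mathbb R^{N\times d}$ (rows $y_k$), $I_\ell(\mathbf x,\mathbf y,x):=\psi(x)^\top\Psi(\mathbf x)^{-1}\mathbf y$ if $\Psi(\mathbf x)$ is invertible and $0$ otherwise. $\operatorname{diam}(A)=\sup_{a,a'\in A}\|a-a'\|_2$ (a tuple is identified with its set of entries); $\operatorname{ch}(A)$ is the convex hull and $\operatorname{ch}_\mu(A):=\{x: \mathrm B^d(x,\mu\operatorname{diam}(A))\subseteq\operatorname{ch}(A)\}$, with $\mathrm B^d(x,r)$ the closed ball. For $\operatorname{diam}(\mathbf x)>0$, $\eta_{\mathbf x}(x):=(x-\frac1N\sum_kx_k)/\operatorname{diam}(\mathbf x)$, applied entrywise to tuples. Sets of interpolation points: for $\mathcal X\subseteq\mathbb R^d$, $s>0$, $\mu\ge0$, $\mathcal H_{\ell,s,\mu}(\mathcal X,x)$ is the set of all $\mathbf x\in\mathcal X^N$ with $x\in\operatorname{ch}_\mu(\mathbf x)$ and $\|\Psi(\eta_{\mathbf x}(\mathbf x))^{-1}\|_{\mathsf{op}}\le s$. Fix constants $s>0$, $D\in(1,\infty)$ and $\mu\in(0,1/N)$. $\mathcal G_{\ell,\delta,s}(\mathcal X)$ is the set of all $x\in\mathbb R^d$ for which there is $\mathbf x\in\mathcal H_{\ell,s,\mu}(\mathcal X,x)$ with $D^{-1}\delta\le\operatorname{diam}(\mathbf x)\le D\delta$. $\chi_{\ell,s}(\mathcal X,x)$ is an element $\mathbf x_0\in\mathcal H_{\ell,2s,0}(\mathcal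 X,x)$ with $\|\Psi(\eta_{\mathbf x_0}(\mathbf x_0))^{-1}\|_{\mathsf{op}}\operatorname{diam}(\mathbf x_0)^{\ell+1}\le2\min_{\mathbf x\in\mathcal H_{\ell,2s,0}(\mathcal X,x)}\|\Psi(\eta_{\mathbf x}(\mathbf x))^{-1}\|_{\mathsf{op}}\operatorname{diam}(\mathbf x)^{\ell+1}$. Moreover $\delta_{\mathsf{NN}}^{\ell,s}(u,T,\mathcal X):=\inf\{\delta'\ge0:\mathcal X\subseteq\mathcal G_{\ell,\delta',s}(u([0,T]))\}$. Estimator: if $\chi_{\ell,s}(\hat u([0,T]),x)$ exists, write it as $\hat{\mathbf x}(x)=(\hat u(\hat\tau_1),\dots,\hat u(\hat\tau_N))$ with $\hat\tau_k\in[0,T]$, set $\hat{\mathbf y}(x):=(\hat{\dot u}(\hat\tau_1),\dots,\hat{\dot u}(\hat\tau_N))$ and $\hat f(x):=I_\ell(\hat{\mathbf x}(x),\hat{\mathbf y}(x),x)$. Otherwise $\hat f(x)$ is not defined by this construction (an arbitrary fallback value may be used).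
   Formalization: The suprema omit points x where interpolation candidates in the estimated curve exist but no χ does (the infimum of the positive objective is 0, so the min is not attained); there the arbitrary fallback value can make the claim false. Points with no candidates are kept. *)

theory Defs
  imports "HOL-Probability.Probability"
begin

section \<open>Asymptotic notation\<close>

text \<open>
  All sequences are nonnegative and taken in \<^typ>\<open>ennreal\<close>, where \<open>a / 0 = \<infinity>\<close> for \<open>a > 0\<close>; with
  real-valued division \<open>a / 0 = 0\<close> would make \<open>a \<prec> 0\<close> true.
\<close>

definition asymp_preceq :: "(nat \<Rightarrow> ennreal) \<Rightarrow> (nat \<Rightarrow> ennreal) \<Rightarrow> bool" where
  "asymp_preceq a b \<longleftrightarrow> limsup (\<lambda>n. a n / b n) < \<infinity>"

definition asymp_prec :: "(nat \<Rightarrow> ennreal) \<Rightarrow> (nat \<Rightarrow> ennreal) \<Rightarrow> bool" where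
  "asymp_prec a b \<longleftrightarrow> limsup (\<lambda>n. a n / b n) = 0"

text \<open>
  The variables \<open>X n\<close> are suprema over uncountable sets and may depend on arbitrary selections, so
  \<open>{X n / a n > B}\<close> need not be measurable. As usual, its probability is then the outer probability:
  the event is covered by a measurable set of probability less than \<open>e\<close>. For measurable events
  this is the ordinary probability.
\<close>

definition bounded_in_prob ::
    "(nat \<Rightarrow> 'w measure) \<Rightarrow> (nat \<Rightarrow> 'w \<Rightarrow> ennreal) \<Rightarrow> (nat \<Rightarrow> ennreal) \<Rightarrow> bool" where
  "bounded_in_prob P X a \<longleftrightarrow>
     (\<forall>e>0. \<exists>B>0. \<exists>n0. \<forall>n\<ge>n0. \<exists>A\<in>sets (P n).
        {\<omega> \<in> space (P n). X n \<omega> / a n > ennreal B} \<subseteq> A \<and> measure (P n) A < e)"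

section \<open>Smoothness classes and the ODE\<close>

text \<open>\<open>iter_deriv f [v1, \<dots>, vk] x\<close> is \<open>D\<^sup>k f(x)\<close> applied to \<open>(v1, \<dots>, vk)\<close>.\<close>

fun iter_deriv ::
    "('a::real_normed_vector \<Rightarrow> 'b::real_normed_vector) \<Rightarrow> 'a list \<Rightarrow> 'a \<Rightarrow> 'b" where
  "iter_deriv f [] x = f x"
| "iter_deriv f (v # vs) x = frechet_derivative (iter_deriv f vs) (at x) v"

definition deriv_opnorm ::
    "('a::real_normed_vector \<Rightarrow> 'b::real_normed_vector) \<Rightarrow> nat \<Rightarrow> 'a \<Rightarrow> ennreal" where
  "deriv_opnorm f k x =
     (SUP vs\<in>{vs. length vs = k \<and> (\<forall>v\<in>set vs. norm v \<le> 1)}. ennreal (norm (iter_deriv f vs x)))"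

text \<open>
  In finite dimension, differentiability and continuity of the multilinear-map-valued \<open>D\<^sup>k f\<close> amount
  to differentiability and continuity of its evaluations at fixed vectors.
\<close>

definition times_cont_diff :: "nat \<Rightarrow> (real^'d \<Rightarrow> real^'d) \<Rightarrow> bool" where
  "times_cont_diff b f \<longleftrightarrow>
     (\<forall>vs. length vs < b \<longrightarrow> (\<forall>x. iter_deriv f vs differentiable (at x))) \<and>
     (\<forall>vs. length vs \<le> b \<longrightarrow> continuous_on UNIV (iter_deriv f vs))"

definition F_class :: "nat \<Rightarrow> (nat \<Rightarrow> real) \<Rightarrow> (real^'d \<Rightarrow> real^'d) set" where
  "F_class b Ls = {f. times_cont_diff b f \<and>
     (\<forall>k\<le>b. (SUP x. deriv_opnorm f k x) \<le> ennreal (Ls k))}"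

definition ode_solution :: "(real^'d \<Rightarrow> real^'d) \<Rightarrow> real^'d \<Rightarrow> (real \<Rightarrow> real^'d) \<Rightarrow> bool" where
  "ode_solution f x u \<longleftrightarrow> u 0 = x \<and> (\<forall>t. (u has_vector_derivative f (u t)) (at t))"

text \<open>The first argument is the smoothness \<open>p = b + 1\<close>: there are \<open>p - 1\<close> derivatives.\<close>

definition Sigma_class :: "nat \<Rightarrow> real \<Rightarrow> (real \<Rightarrow> real^'d) set" where
  "Sigma_class p L = {g. \<forall>k.
     (\<forall>j<p - 1. \<forall>t. (deriv ^^ j) (\<lambda>r. g r $ k) field_differentiable (at t)) \<and>
     (\<forall>t t'. \<bar>(deriv ^^ (p - 1)) (\<lambda>r. g r $ k) t - (deriv ^^ (p - 1)) (\<lambda>r. g r $ k) t'\<bar>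
              \<le> L * \<bar>t - t'\<bar>)}"

section \<open>Regression model\<close>

definition noise :: "'w measure \<Rightarrow> nat \<Rightarrow> real \<Rightarrow> (nat \<Rightarrow> 'w \<Rightarrow> real^'d) \<Rightarrow> bool" where
  "noise M n \<sigma> \<xi> \<longleftrightarrow> prob_space M \<and> prob_space.indep_vars M (\<lambda>_. borel) \<xi> {1..n} \<and>
     (\<forall>i\<in>{1..n}. integrable M (\<xi> i) \<and> (\<integral>\<omega>. \<xi> i \<omega> \<partial>M) = 0 \<and>
        (\<integral>\<^sup>+\<omega>. ennreal ((norm (\<xi> i \<omega>))\<^sup>2) \<partial>M) \<le> ennreal (\<sigma>\<^sup>2))"

definition data_space :: "nat \<Rightarrow> (nat \<Rightarrow> real \<times> (real^'d)) measure" where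
  "data_space n = PiM {1..n} (\<lambda>_. borel \<Otimes>\<^sub>M borel)"

definition data :: "nat \<Rightarrow> (nat \<Rightarrow> real) \<Rightarrow> (real \<Rightarrow> real^'d) \<Rightarrow> (nat \<Rightarrow> real^'d) \<Rightarrow> nat \<Rightarrow> real \<times> (real^'d)"
  where "data n ts g e = (\<lambda>i\<in>{1..n}. (ts i, g (ts i) + e i))"

text \<open>
  The model as the set of pairs of a regression function and a law of the data: the law alone does
  not determine the regression function off the design points. The noise lives on a probability
  space over \<open>nat \<Rightarrow> real^'d\<close>, which realises every joint law of \<open>n\<close> noise vectors.
\<close>

definition regression_model ::
    "nat \<Rightarrow> (nat \<Rightarrow> real) \<Rightarrow> nat \<Rightarrow> real \<Rightarrow> real \<Rightarrow>
      ((real \<Rightarrow> real^'d) \<times> (nat \<Rightarrow> real \<times> (real^'d)) measure) set" where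
  "regression_model n ts p L \<sigma> = {(g, Q). g \<in> Sigma_class p L \<and>
     (\<exists>(M :: (nat \<Rightarrow> real^'d) measure) \<xi>. noise M n \<sigma> \<xi> \<and>
        Q = distr M (data_space n) (\<lambda>\<omega>. data n ts g (\<lambda>i. \<xi> i \<omega>)))}"

section \<open>Polynomial interpolation\<close>

text \<open>
  Tuples of \<open>N\<close> points are vectors \<open>real^'d^'N\<close>, and \<open>\<alpha> :: 'N \<Rightarrow> 'd \<Rightarrow> nat\<close> enumerates the
  multi-indices of order at most \<open>l\<close>, so that \<open>CARD('N) = (l + d) choose d\<close>.
\<close>

definition multi_indices :: "nat \<Rightarrow> ('d::finite \<Rightarrow> nat) set" where
  "multi_indices l = {a. (\<Sum>i\<in>UNIV. a i) \<le> l}"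

definition psi :: "('N::finite \<Rightarrow> 'd::finite \<Rightarrow> nat) \<Rightarrow> real^'d \<Rightarrow> real^'N" where
  "psi \<alpha> x = (\<chi> j. \<Prod>i\<in>UNIV. (x $ i) ^ \<alpha> j i)"

definition Psi :: "('N::finite \<Rightarrow> 'd::finite \<Rightarrow> nat) \<Rightarrow> real^'d^'N \<Rightarrow> real^'N^'N" where
  "Psi \<alpha> xs = (\<chi> k. psi \<alpha> (xs $ k))"

definition interpolant ::
    "('N::finite \<Rightarrow> 'd::finite \<Rightarrow> nat) \<Rightarrow> real^'d^'N \<Rightarrow> real^'d^'N \<Rightarrow> real^'d \<Rightarrow> real^'d" where
  "interpolant \<alpha> xs ys x =
     (if invertible (Psi \<alpha> xs) then psi \<alpha> x v* (matrix_inv (Psi \<alpha> xs) ** ys) else 0)"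

definition entries :: "real^'d^'N \<Rightarrow> (real^'d) set" where
  "entries xs = range (\<lambda>k. xs $ k)"

definition ch_mu :: "real \<Rightarrow> (real^'d) set \<Rightarrow> (real^'d) set" where
  "ch_mu \<mu> A = {x. cball x (\<mu> * diameter A) \<subseteq> convex hull A}"

definition eta :: "real^'d^'N \<Rightarrow> real^'d \<Rightarrow> real^'d" where
  "eta xs x = (x - (\<Sum>k\<in>UNIV. xs $ k) /\<^sub>R real CARD('N)) /\<^sub>R diameter (entries xs)"

definition Psi_eta :: "('N::finite \<Rightarrow> 'd::finite \<Rightarrow> nat) \<Rightarrow> real^'d^'N \<Rightarrow> real^'N^'N" where
  "Psi_eta \<alpha> xs = Psi \<alpha> (\<chi> k. eta xs (xs $ k))"

definition inv_opnorm :: "real^'N^'N \<Rightarrow> real" where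
  "inv_opnorm A = onorm (\<lambda>v. matrix_inv A *v v)"

definition H_set ::
    "('N::finite \<Rightarrow> 'd::finite \<Rightarrow> nat) \<Rightarrow> real \<Rightarrow> real \<Rightarrow> (real^'d) set \<Rightarrow> real^'d \<Rightarrow> (real^'d^'N) set" where
  "H_set \<alpha> s \<mu> X x = {xs. entries xs \<subseteq> X \<and> x \<in> ch_mu \<mu> (entries xs) \<and>
     diameter (entries xs) > 0 \<and> invertible (Psi_eta \<alpha> xs) \<and> inv_opnorm (Psi_eta \<alpha> xs) \<le> s}"

definition G_set ::
    "('N::finite \<Rightarrow> 'd::finite \<Rightarrow> nat) \<Rightarrow> real \<Rightarrow> real \<Rightarrow> real \<Rightarrow> real \<Rightarrow> (real^'d) set \<Rightarrow> (real^'d) set" where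
  "G_set \<alpha> D \<mu> \<delta> s X = {x. \<exists>xs\<in>H_set \<alpha> s \<mu> X x.
     \<delta> / D \<le> diameter (entries xs) \<and> diameter (entries xs) \<le> D * \<delta>}"

definition objective :: "('N::finite \<Rightarrow> 'd::finite \<Rightarrow> nat) \<Rightarrow> nat \<Rightarrow> real^'d^'N \<Rightarrow> real" where
  "objective \<alpha> l xs = inv_opnorm (Psi_eta \<alpha> xs) * diameter (entries xs) ^ (l + 1)"

text \<open>
  \<open>is_chi\<close> says that \<open>x0\<close> is an admissible choice of \<open>\<chi>(X, x)\<close>. The minimum is taken as an infimum,
  which agrees with it whenever it is attained.
\<close>

definition is_chi ::
    "('N::finite \<Rightarrow> 'd::finite \<Rightarrow> nat) \<Rightarrow> nat \<Rightarrow> real \<Rightarrow> (real^'d) set \<Rightarrow> real^'d \<Rightarrow> real^'d^'N \<Rightarrow> bool" where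
  "is_chi \<alpha> l s X x x0 \<longleftrightarrow> x0 \<in> H_set \<alpha> (2 * s) 0 X x \<and>
     objective \<alpha> l x0 \<le> 2 * (INF xs\<in>H_set \<alpha> (2 * s) 0 X x. objective \<alpha> l xs)"

text \<open>
  The minimum in the definition of \<open>\<chi>\<close> presupposes more than \<open>H \<noteq> {}\<close>: for an arbitrary set \<open>X\<close>,
  well-conditioned tuples in \<open>X\<close> may shrink to \<open>x\<close> (as at a corner of a curve), and then the infimum
  of the positive objective is 0 and there is no candidate for \<open>\<chi>\<close> although \<open>H \<noteq> {}\<close>.
  \<open>chi_meaningful\<close> rules out exactly these points (\<open>chi_meaningful_iff\<close>), so none if the minimum is
  attained (\<open>chi_meaningful_if_min_attained\<close>). Points with \<open>H = {}\<close>, where the fallback is used,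
  satisfy it.
\<close>

definition chi_meaningful ::
    "('N::finite \<Rightarrow> 'd::finite \<Rightarrow> nat) \<Rightarrow> nat \<Rightarrow> real \<Rightarrow> (real^'d) set \<Rightarrow> real^'d \<Rightarrow> bool" where
  "chi_meaningful \<alpha> l s X x \<longleftrightarrow> (H_set \<alpha> (2 * s) 0 X x \<noteq> {} \<longrightarrow> (\<exists>x0. is_chi \<alpha> l s X x x0))"

lemma objective_pos:
  fixes \<alpha> :: "'N::finite \<Rightarrow> 'd::finite \<Rightarrow> nat"
  assumes "xs \<in> H_set \<alpha> s \<mu> X x"
  shows "objective \<alpha> l xs > 0"
proof -
  let ?A = "Psi_eta \<alpha> xs"
  have inv: "invertible ?A" and d: "diameter (entries xs) > 0"
    using assms by (auto simp: H_set_def)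
  have bl: "bounded_linear (\<lambda>v. matrix_inv ?A *v v)"
    by (simp add: linear_conv_bounded_linear[symmetric])
  have "onorm (\<lambda>v. matrix_inv ?A *v v) \<noteq> 0"
  proof
    assume "onorm (\<lambda>v. matrix_inv ?A *v v) = 0"
    then have z: "matrix_inv ?A *v v = 0" for v
      using onorm_eq_0[OF bl] by auto
    have "?A *v (matrix_inv ?A *v 1) = 1"
      using someI_ex[of "\<lambda>B. ?A ** B = mat 1 \<and> B ** ?A = mat 1"] inv
      by (simp add: matrix_vector_mul_assoc matrix_inv_def invertible_def)
    then show False
      using z[of 1] by simp
  qed
  then have "onorm (\<lambda>v. matrix_inv ?A *v v) > 0"
    using onorm_pos_le[OF bl] by linarith
  then show ?thesis
    using d by (simp add: objective_def inv_opnorm_def)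
qed

lemma chi_meaningful_iff:
  fixes \<alpha> :: "'N::finite \<Rightarrow> 'd::finite \<Rightarrow> nat"
  shows "chi_meaningful \<alpha> l s X x \<longleftrightarrow>
    (H_set \<alpha> (2 * s) 0 X x \<noteq> {} \<longrightarrow> (INF xs\<in>H_set \<alpha> (2 * s) 0 X x. objective \<alpha> l xs) > 0)"
proof (cases "H_set \<alpha> (2 * s) 0 X x = {}")
  case True
  then show ?thesis by (simp add: chi_meaningful_def)
next
  case False
  let ?H = "H_set \<alpha> (2 * s) 0 X x"
  have bdd: "bdd_below (objective \<alpha> l ` ?H)"
    by (intro bdd_belowI2[of _ 0]) (use objective_pos less_imp_le in blast)
  have "\<exists>x0. is_chi \<alpha> l s X x x0" if "(INF xs\<in>?H. objective \<alpha> l xs) > 0"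
  proof -
    have "(INF xs\<in>?H. objective \<alpha> l xs) < 2 * (INF xs\<in>?H. objective \<alpha> l xs)"
      using that by linarith
    then obtain x0 where "x0 \<in> ?H" "objective \<alpha> l x0 < 2 * (INF xs\<in>?H. objective \<alpha> l xs)"
      using cINF_less_iff[OF False bdd] by blast
    then show ?thesis
      by (auto simp: is_chi_def less_imp_le)
  qed
  moreover have "(INF xs\<in>?H. objective \<alpha> l xs) > 0" if "is_chi \<alpha> l s X x x0" for x0
    using that objective_pos[of x0 \<alpha> "2 * s" 0 X x l] by (auto simp: is_chi_def)
  ultimately show ?thesis
    using False by (auto simp: chi_meaningful_def)
qed

lemma chi_meaningful_if_min_attained:
  fixes \<alpha> :: "'N::finite \<Rightarrow> 'd::finite \<Rightarrow> nat"
  assumes "H_set \<alpha> (2 * s) 0 X x \<noteq> {} \<Longrightarrow>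
    \<exists>x0\<in>H_set \<alpha> (2 * s) 0 X x. \<forall>xs\<in>H_set \<alpha> (2 * s) 0 X x. objective \<alpha> l x0 \<le> objective \<alpha> l xs"
  shows "chi_meaningful \<alpha> l s X x"
  unfolding chi_meaningful_iff
proof
  let ?H = "H_set \<alpha> (2 * s) 0 X x"
  assume ne: "?H \<noteq> {}"
  then obtain x0 where x0: "x0 \<in> ?H" "\<And>xs. xs \<in> ?H \<Longrightarrow> objective \<alpha> l x0 \<le> objective \<alpha> l xs"
    using assms by blast
  have "objective \<alpha> l x0 \<le> (INF xs\<in>?H. objective \<alpha> l xs)"
    using ne x0(2) by (rule cINF_greatest)
  then show "(INF xs\<in>?H. objective \<alpha> l xs) > 0"
    using objective_pos[OF x0(1), of l] by linarith
qed

text \<open>Valued in \<^typ>\<open>ennreal\<close> so that the infimum of the empty set is \<open>\<infinity>\<close>.\<close>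

definition delta_NN ::
    "('N::finite \<Rightarrow> 'd::finite \<Rightarrow> nat) \<Rightarrow> real \<Rightarrow> real \<Rightarrow> real \<Rightarrow> (real \<Rightarrow> real^'d) \<Rightarrow> real \<Rightarrow> (real^'d) set \<Rightarrow> ennreal"
  where "delta_NN \<alpha> D \<mu> s u T X =
     Inf {ennreal \<delta>' | \<delta>'. \<delta>' \<ge> 0 \<and> X \<subseteq> G_set \<alpha> D \<mu> \<delta>' s (u ` {0..T})}"

text \<open>
  \<open>is_fhat \<dots> x y\<close> says that \<open>y\<close> is an admissible value of the estimator at \<open>x\<close>: if \<open>\<chi>\<close> exists, \<open>y\<close>
  is obtained from some choice of \<open>\<chi>\<close> and of the times \<open>\<tau>\<close>; otherwise \<open>y\<close> is an arbitrary fallback.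
\<close>

definition is_fhat ::
    "('N::finite \<Rightarrow> 'd::finite \<Rightarrow> nat) \<Rightarrow> nat \<Rightarrow> real \<Rightarrow> real \<Rightarrow> (real \<Rightarrow> real^'d) \<Rightarrow> (real \<Rightarrow> real^'d) \<Rightarrow>
      real^'d \<Rightarrow> real^'d \<Rightarrow> bool" where
  "is_fhat \<alpha> l s T u du x y \<longleftrightarrow>
     ((\<exists>x0. is_chi \<alpha> l s (u ` {0..T}) x x0) \<longrightarrow>
      (\<exists>x0 \<tau>. is_chi \<alpha> l s (u ` {0..T}) x x0 \<and>
         (\<forall>k. \<tau> k \<in> {0..T} \<and> x0 $ k = u (\<tau> k)) \<and>
         y = interpolant \<alpha> x0 (\<chi> k. du (\<tau> k)) x))"

end

theory Submission
  imports Defs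
begin

text \<open>
  \<^emph>\<open>Regression model.\<close> Differentiating \<open>u' = f(u)\<close> repeatedly writes the derivative of order
  \<open>m + 1\<close> of \<open>u\<close> as a sum of \<open>m!\<close> elementary differentials, each a composition of \<open>m + 1\<close> derivatives
  of \<open>f\<close>. Hence \<open>u\<^sup>\<star>\<close> lies in the class of regression functions with the constant \<open>L\<close> of the theorem,
  and the assumed bounds apply to the estimates of \<open>u\<^sup>\<star>\<close> and of its derivative \<open>f\<^sup>\<star>(u\<^sup>\<star>)\<close>.

  \<^emph>\<open>Stability.\<close> If \<open>x\<close> has a well-conditioned tuple of diameter of order \<open>\<delta>\<close> on the true trajectory,
  then replacing its points by their estimates moves them by \<open>O(\<Gamma>)\<close>, which is negligible against
  \<open>\<delta>\<close>. The margin \<open>\<mu>\<close> keeps \<open>x\<close> in the convex hull and the condition number at most doubles, so the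
  tuple is a candidate for \<open>\<chi>\<close> and the objective of the chosen tuple is \<open>O(\<delta>\<^sup>\<beta>)\<close>.

  \<^emph>\<open>Interpolation error.\<close> The interpolant is a weighted sum \<open>\<Sum> w\<^sub>k y\<^sub>k\<close> whose weights reproduce
  polynomials of degree at most \<open>l\<close> and are bounded by the condition number. Applied to the Taylor
  polynomial of \<open>f\<^sup>\<star>\<close> at \<open>x\<close>, this bounds the error by the condition number times
  \<open>\<Lambda> + \<Gamma> + diam\<^sup>\<beta>\<close>; the part with \<open>diam\<^sup>\<beta>\<close> is the objective.
\<close>

section \<open>Regularity of solutions of the ODE\<close>

lemma linear_expand_Basis:
  fixes h :: "'a::euclidean_space \<Rightarrow> 'b::real_vector"
  assumes "linear h"
  shows "h v = (\<Sum>b\<in>Basis. (v \<bullet> b) *\<^sub>R h b)"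
  by (metis (no_types, lifting) assms euclidean_representation linear_scale linear_sum sum.cong)

lemma iter_deriv_has_derivative:
  assumes "times_cont_diff b f" "length vs < b"
  shows "(iter_deriv f vs has_derivative (\<lambda>v. iter_deriv f (v # vs) x)) (at x)"
  using assms by (simp add: times_cont_diff_def frechet_derivative_works)

text \<open>The head of the list is the direction of the last differentiation, so linearity in it is
  that of a derivative. A slot further inside inherits linearity: an identity that expresses
  linearity in \<open>v\<close> survives differentiation in the direction \<open>w\<close>, by
  uniqueness of derivatives.\<close>

lemma iter_deriv_linear:
  assumes f: "times_cont_diff b f"
  shows "length ws + length vs < b \<Longrightarrow> linear (\<lambda>v. iter_deriv f (ws @ v # vs) x)"
proof (induction ws arbitrary: x)
  case Nil
  then show ?case
    using iter_deriv_has_derivative[OF f, of vs x] has_derivative_linear by auto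
next
  case (Cons w ws)
  have lin: "linear (\<lambda>v. iter_deriv f (ws @ v # vs) y)" for y
    using Cons by simp
  have hd: "(iter_deriv f (ws @ v # vs) has_derivative (\<lambda>w. iter_deriv f (w # ws @ v # vs) x)) (at x)" for v
    using Cons.prems by (intro iter_deriv_has_derivative[OF f]) simp
  show ?case
  proof (rule linearI)
    fix v v'
    have "iter_deriv f (ws @ (v + v') # vs) = (\<lambda>y. iter_deriv f (ws @ v # vs) y + iter_deriv f (ws @ v' # vs) y)"
      by (rule ext) (rule linear_add[OF lin])
    then have "(\<lambda>w. iter_deriv f (w # ws @ (v + v') # vs) x) =
        (\<lambda>w. iter_deriv f (w # ws @ v # vs) x + iter_deriv f (w # ws @ v' # vs) x)"
      using has_derivative_unique[OF hd[of "v + v'"]] has_derivative_add[OF hd[of v] hd[of v']] by simp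
    then show "iter_deriv f ((w # ws) @ (v + v') # vs) x =
        iter_deriv f ((w # ws) @ v # vs) x + iter_deriv f ((w # ws) @ v' # vs) x"
      by (auto dest: fun_cong)
  next
    fix c v
    have "iter_deriv f (ws @ (c *\<^sub>R v) # vs) = (\<lambda>y. c *\<^sub>R iter_deriv f (ws @ v # vs) y)"
      by (rule ext) (rule linear_scale[OF lin])
    then have "(\<lambda>w. iter_deriv f (w # ws @ (c *\<^sub>R v) # vs) x) =
        (\<lambda>w. c *\<^sub>R iter_deriv f (w # ws @ v # vs) x)"
      using has_derivative_unique[OF hd[of "c *\<^sub>R v"]] has_derivative_scaleR_right[OF hd[of v], of c] by simp
    then show "iter_deriv f ((w # ws) @ (c *\<^sub>R v) # vs) x = c *\<^sub>R iter_deriv f ((w # ws) @ v # vs) x"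
      by (auto dest: fun_cong)
  qed
qed

lemma iter_deriv_linear_update:
  assumes "times_cont_diff b f" "length vs \<le> b" "i < length vs"
  shows "linear (\<lambda>v. iter_deriv f (vs[i := v]) x)"
  using iter_deriv_linear[OF assms(1), of "take i vs" "drop (Suc i) vs" x] assms(2,3)
  by (simp add: upd_conv_take_nth_drop)

lemma F_class_times_cont_diff: "f \<in> F_class b Ls \<Longrightarrow> times_cont_diff b f"
  by (simp add: F_class_def)

lemma F_class_norm_iter_deriv_unit:
  assumes "f \<in> F_class b Ls" "length vs \<le> b" "\<And>v. v \<in> set vs \<Longrightarrow> norm v \<le> 1"
    and "Ls (length vs) \<ge> 0"
  shows "norm (iter_deriv f vs x) \<le> Ls (length vs)"
proof -
  have "ennreal (norm (iter_deriv f vs x)) \<le> deriv_opnorm f (length vs) x"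
    unfolding deriv_opnorm_def using assms(3) by (intro SUP_upper) auto
  also have "\<dots> \<le> (SUP x. deriv_opnorm f (length vs) x)"
    by (intro SUP_upper) auto
  also have "\<dots> \<le> ennreal (Ls (length vs))"
    using assms(1,2) by (simp add: F_class_def)
  finally show ?thesis
    using assms(4) by simp
qed

lemma F_class_norm_iter_deriv:
  assumes f: "f \<in> F_class b Ls" and Ls: "\<And>k. k \<le> b \<Longrightarrow> Ls k \<ge> 0"
    and len: "length vs \<le> b"
  shows "norm (iter_deriv f vs x) \<le> Ls (length vs) * prod_list (map norm vs)"
proof -
  \<comment> \<open>The slots in \<open>ws\<close> are already normalised; the induction moves one
    vector after the other from \<open>vs\<close> to \<open>ws\<close> and pulls out its norm by
    linearity.\<close>
  have "norm (iter_deriv f (ws @ vs) x) \<le> Ls (length (ws @ vs)) * prod_list (map norm vs)"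
    if "length (ws @ vs) \<le> b" "\<And>v. v \<in> set ws \<Longrightarrow> norm v \<le> 1" for ws vs
    using that
  proof (induction vs arbitrary: ws)
    case Nil
    then show ?case
      using F_class_norm_iter_deriv_unit[OF f, of ws x] Ls by simp
  next
    case (Cons v vs)
    have lin: "linear (\<lambda>v. iter_deriv f (ws @ v # vs) x)"
      using Cons.prems by (intro iter_deriv_linear[OF F_class_times_cont_diff[OF f]]) simp
    have "v = norm v *\<^sub>R sgn v"
      by (cases "v = 0") (simp_all add: sgn_div_norm)
    then have "iter_deriv f (ws @ v # vs) x = norm v *\<^sub>R iter_deriv f ((ws @ [sgn v]) @ vs) x"
      using linear_scale[OF lin, of "norm v" "sgn v"] by simp
    moreover have "norm (iter_deriv f ((ws @ [sgn v]) @ vs) x) \<le>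
        Ls (length ((ws @ [sgn v]) @ vs)) * prod_list (map norm vs)"
      using Cons.prems by (intro Cons.IH) (auto simp: norm_sgn)
    ultimately show ?case
      using mult_left_mono[of _ _ "norm v"] by (fastforce simp: mult.left_commute)
  qed
  from this[of "[]" vs] show ?thesis
    using len by simp
qed

text \<open>The induction freezes the moving slots one at a time: the first one is expanded in the
  basis, which leaves real coefficient functions times expressions in which a fixed basis vector has
  joined \<open>ws\<close>. The first term of the result comes from the moving base point, the sum
  from the moving slots.\<close>

lemma iter_deriv_has_vector_derivative:
  fixes u :: "real \<Rightarrow> real^'d"
  assumes f: "times_cont_diff b f" and u: "(u has_vector_derivative u') (at t)"
  shows "list_all2 (\<lambda>h h'. (h has_vector_derivative h') (at t)) hs hs' \<Longrightarrow> length ws + length hs < b \<Longrightarrow>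
    ((\<lambda>r. iter_deriv f (ws @ map (\<lambda>h. h r) hs) (u r)) has_vector_derivative
      (iter_deriv f (u' # ws @ map (\<lambda>h. h t) hs) (u t) +
       (\<Sum>i<length hs. iter_deriv f (ws @ (map (\<lambda>h. h t) hs)[i := hs' ! i]) (u t)))) (at t)"
proof (induction hs arbitrary: hs' ws)
  case Nil
  have "(iter_deriv f ws has_derivative (\<lambda>v. iter_deriv f (v # ws) (u t))) (at (u t))"
    using Nil by (intro iter_deriv_has_derivative[OF f]) simp
  from vector_derivative_diff_chain_within[OF u has_derivative_at_withinI[OF this, of "range u"]]
  show ?case by (simp add: o_def)
next
  case (Cons h hs)
  obtain h' hs'' where hs': "hs' = h' # hs''" "(h has_vector_derivative h') (at t)"
      "list_all2 (\<lambda>h h'. (h has_vector_derivative h') (at t)) hs hs''"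
    using Cons.prems(1) by (auto simp: list_all2_Cons1)
  have lens: "length ws + length hs < b" "length (u' # ws) + length hs < b"
    using Cons.prems(2) by auto
  let ?I = "\<lambda>vs. iter_deriv f vs (u t)"
  let ?vs = "map (\<lambda>h. h t) hs"
  have lin: "linear (\<lambda>v. iter_deriv f (ws @ v # vs) x)" if "length vs = length hs" for vs x
    using lens that by (intro iter_deriv_linear[OF f]) simp
  have lin': "linear (\<lambda>v. iter_deriv f ((u' # ws) @ v # vs) x)" if "length vs = length hs" for vs x
    using lens that by (intro iter_deriv_linear[OF f]) simp
  have "((\<lambda>r. iter_deriv f ((ws @ [b]) @ map (\<lambda>h. h r) hs) (u r)) has_vector_derivative
      (?I (u' # (ws @ [b]) @ ?vs) + (\<Sum>i<length hs. ?I ((ws @ [b]) @ ?vs[i := hs'' ! i])))) (at t)" for b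
    using Cons.prems(2) by (intro Cons.IH hs') simp
  then have IH: "((\<lambda>r. iter_deriv f (ws @ b # map (\<lambda>h. h r) hs) (u r)) has_vector_derivative
      (?I (u' # ws @ b # ?vs) + (\<Sum>i<length hs. ?I (ws @ b # ?vs[i := hs'' ! i])))) (at t)" for b
    by simp
  have *: "((\<lambda>r. h r \<bullet> b) has_field_derivative h' \<bullet> b) (at t)" for b
    using hs'(2) by (auto simp: has_vector_derivative_def has_field_derivative_def
        intro!: derivative_eq_intros)
  have eq: "(\<lambda>r. iter_deriv f (ws @ map (\<lambda>h. h r) (h # hs)) (u r)) =
      (\<lambda>r. \<Sum>b\<in>Basis. (h r \<bullet> b) *\<^sub>R iter_deriv f (ws @ b # map (\<lambda>h. h r) hs) (u r))"
    by (rule ext, subst linear_expand_Basis[OF lin, symmetric]) auto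
  have der: "((\<lambda>r. \<Sum>b\<in>Basis. (h r \<bullet> b) *\<^sub>R iter_deriv f (ws @ b # map (\<lambda>h. h r) hs) (u r)) has_vector_derivative
      (\<Sum>b\<in>Basis. (h t \<bullet> b) *\<^sub>R (?I (u' # ws @ b # ?vs) + (\<Sum>i<length hs. ?I (ws @ b # ?vs[i := hs'' ! i])))
        + (h' \<bullet> b) *\<^sub>R ?I (ws @ b # ?vs))) (at t)"
    by (intro has_vector_derivative_sum has_vector_derivative_scaleR IH *)
  have "(\<Sum>b\<in>Basis. (h t \<bullet> b) *\<^sub>R ?I (u' # ws @ b # ?vs)) = ?I (u' # ws @ h t # ?vs)"
    using linear_expand_Basis[OF lin'[of ?vs "u t"], of "h t"] by simp
  moreover have "(\<Sum>b\<in>Basis. (h' \<bullet> b) *\<^sub>R ?I (ws @ b # ?vs)) = ?I (ws @ h' # ?vs)"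
    using linear_expand_Basis[OF lin[of ?vs "u t"], of "h'"] by simp
  moreover have "(\<Sum>b\<in>Basis. (h t \<bullet> b) *\<^sub>R (\<Sum>i<length hs. ?I (ws @ b # ?vs[i := hs'' ! i]))) =
      (\<Sum>i<length hs. ?I (ws @ h t # ?vs[i := hs'' ! i]))"
    unfolding scaleR_sum_right
    by (subst sum.swap, rule sum.cong[OF refl], subst linear_expand_Basis[OF lin, symmetric]) auto
  ultimately have "(\<Sum>b\<in>Basis. (h t \<bullet> b) *\<^sub>R (?I (u' # ws @ b # ?vs) + (\<Sum>i<length hs. ?I (ws @ b # ?vs[i := hs'' ! i])))
        + (h' \<bullet> b) *\<^sub>R ?I (ws @ b # ?vs)) =
      ?I (u' # ws @ map (\<lambda>h. h t) (h # hs)) +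
       (\<Sum>i<length (h # hs). ?I (ws @ (map (\<lambda>h. h t) (h # hs))[i := hs' ! i]))"
    unfolding hs'(1) length_Cons sum.lessThan_Suc_shift
    by (simp add: scaleR_add_right sum.distrib)
  then show ?case
    unfolding eq using der by simp
qed

text \<open>
  \<open>elem_diff f u \<tau>\<close> is the elementary differential of \<open>f\<close> for the rooted tree \<open>\<tau>\<close>, evaluated along the
  trajectory \<open>u\<close>: a node with \<open>k\<close> children stands for the derivative of \<open>f\<close> of order \<open>k\<close>. Along a
  solution of the ODE, differentiating it attaches a leaf to one of the nodes in all possible ways.
\<close>

datatype rtree = Node "rtree list"

primrec nodes :: "rtree \<Rightarrow> nat" where
  "nodes (Node ts) = Suc (sum_list (map nodes ts))"

primrec elem_diff :: "(real^'d \<Rightarrow> real^'d) \<Rightarrow> (real \<Rightarrow> real^'d) \<Rightarrow> rtree \<Rightarrow> real \<Rightarrow> real^'d" where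
  "elem_diff f u (Node ts) = (\<lambda>t. iter_deriv f (map (\<lambda>h. h t) (map (elem_diff f u) ts)) (u t))"

lemma sum_list_of_concat: "sum_list (concat xss) = sum_list (map sum_list xss)"
  by (induction xss) auto

lemma nodes_le_sum_list: "s \<in> set ts \<Longrightarrow> nodes s \<le> sum_list (map nodes ts)"
  by (induction ts) auto

lemma length_le_nodes: "length ts \<le> sum_list (map nodes ts)"
proof (induction ts)
  case (Cons t ts)
  then show ?case by (cases t) auto
qed simp

lemma elem_diff_has_vector_derivative:
  fixes u :: "real \<Rightarrow> real^'d"
  assumes f: "times_cont_diff b f" and u: "\<And>t. (u has_vector_derivative f (u t)) (at t)"
  shows "nodes \<tau> \<le> b \<Longrightarrow> \<exists>ss. length ss = nodes \<tau> \<and> (\<forall>s\<in>set ss. nodes s = Suc (nodes \<tau>)) \<and>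
    (\<forall>t. (elem_diff f u \<tau> has_vector_derivative (\<Sum>s\<leftarrow>ss. elem_diff f u s t)) (at t))"
proof (induction \<tau>)
  case (Node ts)
  let ?E = "elem_diff f u"
  \<comment> \<open>The root has fewer children than the tree has nodes, so it stands for a
    derivative of order below \<open>b\<close>, which can be differentiated once more.\<close>
  have lts: "length ts < b"
    using Node.prems length_le_nodes[of ts] by simp
  have "\<forall>\<tau>\<in>set ts. \<exists>ss. length ss = nodes \<tau> \<and> (\<forall>s\<in>set ss. nodes s = Suc (nodes \<tau>)) \<and>
      (\<forall>t. (?E \<tau> has_vector_derivative (\<Sum>s\<leftarrow>ss. ?E s t)) (at t))"
    using Node nodes_le_sum_list[of _ ts] by fastforce
  then obtain g where g: "\<And>\<tau>. \<tau> \<in> set ts \<Longrightarrow> length (g \<tau>) = nodes \<tau>"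
      "\<And>\<tau> s. \<tau> \<in> set ts \<Longrightarrow> s \<in> set (g \<tau>) \<Longrightarrow> nodes s = Suc (nodes \<tau>)"
      "\<And>\<tau> t. \<tau> \<in> set ts \<Longrightarrow> (?E \<tau> has_vector_derivative (\<Sum>s\<leftarrow>g \<tau>. ?E s t)) (at t)"
    by metis
  \<comment> \<open>The first tree attaches the leaf to the root: the base point moves with velocity
    \<open>f (u t)\<close>, the elementary differential of \<open>Node []\<close>. The others attach
    it inside child \<open>i\<close>, where \<open>g\<close> lists the outcomes.\<close>
  define ss where "ss = Node (Node [] # ts) #
    concat (map (\<lambda>i. map (\<lambda>s. Node (ts[i := s])) (g (ts ! i))) [0..<length ts])"
  have nodes_upd: "sum_list (map nodes (ts[i := s])) + nodes (ts ! i) = sum_list (map nodes ts) + nodes s"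
    if "i < length ts" for i s
  proof -
    have "sum_list (map nodes ts) = sum_list (map nodes (take i ts @ ts ! i # drop (Suc i) ts))"
      using id_take_nth_drop[OF that] by simp
    then show ?thesis
      using that by (simp add: upd_conv_take_nth_drop)
  qed
  have "length ss = nodes (Node ts)"
  proof -
    have "(\<Sum>i\<leftarrow>[0..<length ts]. length (g (ts ! i))) = sum_list (map nodes ts)"
      by (simp add: sum_list_sum_nth interv_sum_list_conv_sum_set_nat g(1))
    then show ?thesis
      by (simp add: ss_def length_concat o_def)
  qed
  moreover have "\<forall>s\<in>set ss. nodes s = Suc (nodes (Node ts))"
  proof
    fix s assume "s \<in> set ss"
    then consider "s = Node (Node [] # ts)"
      | i s' where "i < length ts" "s = Node (ts[i := s'])" "s' \<in> set (g (ts ! i))"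
      by (auto simp: ss_def)
    then show "nodes s = Suc (nodes (Node ts))"
    proof cases
      case 2
      then show ?thesis
        using nodes_upd[of i s'] g(2)[of "ts ! i" s'] by simp
    qed simp
  qed
  moreover have "(?E (Node ts) has_vector_derivative (\<Sum>s\<leftarrow>ss. ?E s t)) (at t)" for t
  proof -
    let ?vs = "map (\<lambda>h. h t) (map ?E ts)"
    let ?hs' = "map (\<lambda>\<tau>. \<Sum>s\<leftarrow>g \<tau>. ?E s t) ts"
    have "((\<lambda>r. iter_deriv f ([] @ map (\<lambda>h. h r) (map ?E ts)) (u r)) has_vector_derivative
      (iter_deriv f (f (u t) # [] @ ?vs) (u t) +
       (\<Sum>i<length (map ?E ts). iter_deriv f ([] @ ?vs[i := ?hs' ! i]) (u t)))) (at t)"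
      using lts by (intro iter_deriv_has_vector_derivative[OF f u])
        (auto simp: list_all2_conv_all_nth g(3))
    \<comment> \<open>The derivative of child \<open>i\<close> is a sum over
      \<open>g (ts ! i)\<close>; linearity in slot \<open>i\<close> carries this sum
      outside.\<close>
    moreover have "iter_deriv f (?vs[i := ?hs' ! i]) (u t) = (\<Sum>s\<leftarrow>g (ts ! i). ?E (Node (ts[i := s])) t)"
      if "i < length ts" for i
    proof -
      have lin: "linear (\<lambda>v. iter_deriv f (?vs[i := v]) (u t))"
        using that lts by (intro iter_deriv_linear_update[OF f]) auto
      have "iter_deriv f (?vs[i := sum_list (map w ss)]) (u t) =
          (\<Sum>s\<leftarrow>ss. iter_deriv f (?vs[i := w s]) (u t))" for w and ss :: "rtree list"
        using linear_0[OF lin] linear_add[OF lin] by (induction ss) auto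
      then show ?thesis
        using that by (simp add: map_update o_def)
    qed
    ultimately show ?thesis
      by (simp add: ss_def map_concat o_def sum_list_of_concat interv_sum_list_conv_sum_set_nat
          lessThan_atLeast0 o_def)
  qed
  ultimately show ?case by blast
qed

text \<open>Each node contributes one derivative of \<open>f\<close> and hence one factor of at most
  \<open>M\<close>. With at most \<open>b + 1\<close> nodes no node has more than \<open>b\<close>
  children, so only orders covered by the class occur.\<close>

lemma norm_elem_diff:
  assumes f: "f \<in> F_class b Ls" and Ls: "\<And>k. k \<le> b \<Longrightarrow> 0 \<le> Ls k \<and> Ls k \<le> M"
  shows "nodes \<tau> \<le> Suc b \<Longrightarrow> norm (elem_diff f u \<tau> t) \<le> M ^ nodes \<tau>"
proof (induction \<tau>)
  case (Node ts)
  have M: "M \<ge> 0" using Ls[of 0] by simp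
  have lts: "length ts \<le> b"
    using Node.prems length_le_nodes[of ts] by simp
  have IH: "norm (elem_diff f u s t) \<le> M ^ nodes s" if "s \<in> set ts" for s
    using Node nodes_le_sum_list[of s ts] that by fastforce
  have "norm (elem_diff f u (Node ts) t) \<le>
      Ls (length ts) * prod_list (map (\<lambda>s. norm (elem_diff f u s t)) ts)"
    using F_class_norm_iter_deriv[OF f, of "map (\<lambda>h. h t) (map (elem_diff f u) ts)" "u t"] Ls lts
    by (simp add: o_def)
  also have "\<dots> \<le> M * M ^ sum_list (map nodes ts)"
  proof (rule mult_mono)
    show "prod_list (map (\<lambda>s. norm (elem_diff f u s t)) ts) \<le> M ^ sum_list (map nodes ts)"
      using IH
    proof (induction ts)
      case (Cons s ts)
      then show ?case
        by (auto simp: power_add M intro!: mult_mono prod_list_nonneg)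
    qed simp
  qed (use Ls lts M in \<open>auto intro!: prod_list_nonneg\<close>)
  finally show ?case by simp
qed

text \<open>The claim is about the derivative of the iterate of order \<open>m\<close>, not about
  the iterate of order \<open>m + 1\<close>: existence of the derivative is then part of the
  induction, whereas \<open>deriv\<close> alone would not provide it.\<close>

lemma iterated_deriv_ode_solution:
  fixes u :: "real \<Rightarrow> real^'d"
  assumes f: "times_cont_diff b f" and u: "\<And>t. (u has_vector_derivative f (u t)) (at t)"
  shows "m \<le> b \<Longrightarrow> \<exists>ss. length ss = fact m \<and> (\<forall>s\<in>set ss. nodes s = Suc m) \<and>
    (\<forall>k t. ((deriv ^^ m) (\<lambda>r. u r $ k) has_field_derivative (\<Sum>s\<leftarrow>ss. elem_diff f u s t $ k)) (at t))"
proof (induction m)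
  case 0
  have "((\<lambda>r. u r $ k) has_field_derivative f (u t) $ k) (at t)" for k t
    using bounded_linear.has_vector_derivative[OF bounded_linear_vec_nth u]
    by (simp add: has_real_derivative_iff_has_vector_derivative)
  then show ?case
    by (intro exI[of _ "[Node []]"]) simp
next
  case (Suc m)
  then obtain ss where ss: "length ss = fact m" "\<And>s. s \<in> set ss \<Longrightarrow> nodes s = Suc m"
     "\<And>k t. ((deriv ^^ m) (\<lambda>r. u r $ k) has_field_derivative (\<Sum>s\<leftarrow>ss. elem_diff f u s t $ k)) (at t)"
    by auto
  have eq: "(deriv ^^ Suc m) (\<lambda>r. u r $ k) = (\<lambda>t. \<Sum>s\<leftarrow>ss. elem_diff f u s t $ k)" for k
    using DERIV_imp_deriv[OF ss(3)] by auto
  have "\<forall>\<tau>\<in>set ss. \<exists>ss. length ss = nodes \<tau> \<and> (\<forall>s\<in>set ss. nodes s = Suc (nodes \<tau>)) \<and>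
      (\<forall>t. (elem_diff f u \<tau> has_vector_derivative (\<Sum>s\<leftarrow>ss. elem_diff f u s t)) (at t))"
    using elem_diff_has_vector_derivative[OF f u] ss(2) Suc.prems by (metis Suc_leD)
  then obtain g where g: "\<And>\<tau>. \<tau> \<in> set ss \<Longrightarrow> length (g \<tau>) = nodes \<tau>"
      "\<And>\<tau> s. \<tau> \<in> set ss \<Longrightarrow> s \<in> set (g \<tau>) \<Longrightarrow> nodes s = Suc (nodes \<tau>)"
      "\<And>\<tau> t. \<tau> \<in> set ss \<Longrightarrow> (elem_diff f u \<tau> has_vector_derivative (\<Sum>s\<leftarrow>g \<tau>. elem_diff f u s t)) (at t)"
    by metis
  let ?ss = "concat (map g ss)"
  \<comment> \<open>Each of the \<open>fact m\<close> trees has \<open>m + 1\<close> nodes and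
    yields one tree per node, which gives \<open>fact (m + 1)\<close> trees.\<close>
  have "map (\<lambda>s. length (g s)) ss = map (\<lambda>s. Suc m) ss"
    using g(1) ss(2) by simp
  then have "length ?ss = fact (Suc m)"
    unfolding length_concat map_map o_def by (simp only: sum_list_triv ss(1)) simp
  moreover have "\<forall>s\<in>set ?ss. nodes s = Suc (Suc m)"
    using g(2) ss(2) by auto
  moreover have "((deriv ^^ Suc m) (\<lambda>r. u r $ k) has_field_derivative (\<Sum>s\<leftarrow>?ss. elem_diff f u s t $ k)) (at t)" for k t
  proof -
    have comp: "sum_list (map h ss) $ k = (\<Sum>s\<leftarrow>ss. h s $ k)" for h :: "rtree \<Rightarrow> real^'d" and ss k
      by (induction ss) auto
    have "((\<lambda>r. elem_diff f u \<tau> r $ k) has_field_derivative (\<Sum>s\<leftarrow>g \<tau>. elem_diff f u s t $ k)) (at t)"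
      if "\<tau> \<in> set ss" for \<tau>
      using bounded_linear.has_vector_derivative[OF bounded_linear_vec_nth g(3)[OF that]]
      by (simp add: has_real_derivative_iff_has_vector_derivative comp)
    then have "((\<lambda>t. \<Sum>s\<leftarrow>ss'. elem_diff f u s t $ k) has_field_derivative
        (\<Sum>\<tau>\<leftarrow>ss'. \<Sum>s\<leftarrow>g \<tau>. elem_diff f u s t $ k)) (at t)" if "set ss' \<subseteq> set ss" for ss'
      using that
    proof (induction ss')
      case (Cons s ss')
      then have "((\<lambda>t. elem_diff f u s t $ k) has_field_derivative (\<Sum>s\<leftarrow>g s. elem_diff f u s t $ k)) (at t)"
        "((\<lambda>t. \<Sum>s\<leftarrow>ss'. elem_diff f u s t $ k) has_field_derivative
          (\<Sum>\<tau>\<leftarrow>ss'. \<Sum>s\<leftarrow>g \<tau>. elem_diff f u s t $ k)) (at t)"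
        by simp_all
      from DERIV_add[OF this] show ?case
        by simp
    qed simp
    from this[of ss] show ?thesis
      unfolding eq by (simp add: map_concat sum_list_of_concat o_def)
  qed
  ultimately show ?case by blast
qed

text \<open>The derivative of order \<open>b\<close> is differentiable once more, and this last
  derivative is a sum of \<open>fact b\<close> terms bounded by \<open>M ^ Suc b\<close>; the mean
  value inequality gives the Lipschitz condition.\<close>

lemma ode_solution_Sigma_class:
  fixes u :: "real \<Rightarrow> real^'d"
  assumes f: "f \<in> F_class b Ls" and u: "\<And>t. (u has_vector_derivative f (u t)) (at t)"
    and Ls: "\<And>k. k \<le> b \<Longrightarrow> 0 \<le> Ls k \<and> Ls k \<le> M" and L: "fact b * M ^ Suc b \<le> L"
  shows "u \<in> Sigma_class (b + 1) L"
  unfolding Sigma_class_def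
proof (safe, goal_cases)
  case (1 k j t)
  then show ?case
    using iterated_deriv_ode_solution[OF F_class_times_cont_diff[OF f] u, of j]
    by (auto simp: field_differentiable_def)
next
  case (2 k t t')
  obtain ss where ss: "length ss = fact b" "\<And>s. s \<in> set ss \<Longrightarrow> nodes s = Suc b"
     "\<And>t. ((deriv ^^ b) (\<lambda>r. u r $ k) has_field_derivative (\<Sum>s\<leftarrow>ss. elem_diff f u s t $ k)) (at t)"
    using iterated_deriv_ode_solution[OF F_class_times_cont_diff[OF f] u, of b] by blast
  have "norm (\<Sum>s\<leftarrow>ss. elem_diff f u s t $ k) \<le> L" for t
  proof -
    have "\<bar>elem_diff f u s t $ k\<bar> \<le> M ^ Suc b" if "s \<in> set ss" for s
      using norm_elem_diff[OF f Ls, of s u t] ss(2)[OF that] component_le_norm_cart[of "elem_diff f u s t" k]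
      by simp
    then have "norm (\<Sum>s\<leftarrow>ss'. elem_diff f u s t $ k) \<le> length ss' * M ^ Suc b" if "set ss' \<subseteq> set ss" for ss'
      using that by (induction ss') (fastforce simp: algebra_simps)+
    from this[of ss] show ?thesis
      using L ss(1) by simp
  qed
  then have "norm ((deriv ^^ b) (\<lambda>r. u r $ k) t - (deriv ^^ b) (\<lambda>r. u r $ k) t') \<le> L * norm (t - t')"
    using ss(3) by (intro field_differentiable_bound[where S = UNIV]) (auto intro: DERIV_subset)
  then show ?case by simp
qed

section \<open>Polynomials and Taylor expansion\<close>

text \<open>Polynomial functions are generated without reference to coefficients, so that closure
  properties and linear relations between values are proved by induction over three rules, of which
  only \<open>coord\<close> raises the degree.\<close>

inductive poly_le :: "nat \<Rightarrow> (real^'d \<Rightarrow> real) \<Rightarrow> bool" where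
  const: "poly_le k (\<lambda>x. c)"
| add: "poly_le k p \<Longrightarrow> poly_le k q \<Longrightarrow> poly_le k (\<lambda>x. p x + q x)"
| coord: "poly_le k p \<Longrightarrow> poly_le (Suc k) (\<lambda>x. x $ i * p x)"

lemma poly_le_mono: "poly_le k p \<Longrightarrow> k \<le> m \<Longrightarrow> poly_le m p"
proof (induction arbitrary: m rule: poly_le.induct)
  case (coord k p i)
  then show ?case
    using poly_le.coord[of "m - 1" p i] by (cases m) auto
qed (auto intro: poly_le.intros)

lemma poly_le_cmult: "poly_le k p \<Longrightarrow> poly_le k (\<lambda>x. c * p x)"
proof (induction rule: poly_le.induct)
  case (add k p q)
  then show ?case
    using poly_le.add by (fastforce simp: distrib_left)
next
  case (coord k p i)
  then show ?case
    using poly_le.coord[of k "\<lambda>x. c * p x" i] by (simp add: mult.left_commute)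
qed (rule poly_le.const)

lemma poly_le_sum: "(\<And>i. i \<in> A \<Longrightarrow> poly_le k (p i)) \<Longrightarrow> poly_le k (\<lambda>x. \<Sum>i\<in>A. p i x)"
  by (induction A rule: infinite_finite_induct) (auto intro: poly_le.intros)

lemma poly_le_affine_coord:
  assumes "poly_le k p"
  shows "poly_le (Suc k) (\<lambda>x. (r * x $ i + v) * p x)"
  using poly_le.add[OF poly_le_cmult[OF poly_le.coord[OF assms, of i], of r]
      poly_le_mono[OF poly_le_cmult[OF assms, of v] le_SucI[OF le_refl]]]
  by (simp add: algebra_simps)

lemma poly_le_affine: "poly_le k p \<Longrightarrow> poly_le k (\<lambda>x. p (r *\<^sub>R x + v))"
proof (induction rule: poly_le.induct)
  case (coord k p i)
  then show ?case
    using poly_le_affine_coord[OF coord.IH, of r i "v $ i"] by simp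
qed (auto intro: poly_le.intros)

lemma poly_le_mult: "poly_le a p \<Longrightarrow> poly_le b q \<Longrightarrow> poly_le (a + b) (\<lambda>x. p x * q x)"
proof (induction rule: poly_le.induct)
  case (const k c)
  then show ?case
    using poly_le_mono[OF poly_le_cmult[OF const, of c], of "k + b"] by simp
next
  case (add k p p')
  then show ?case
    using poly_le.add by (fastforce simp: distrib_right)
next
  case (coord k p i)
  then show ?case
    using poly_le.coord[of "k + b" "\<lambda>x. p x * q x" i] by (simp add: mult.assoc)
qed

lemma poly_le_monomial: "finite I \<Longrightarrow> poly_le (\<Sum>i\<in>I. a i) (\<lambda>x. \<Prod>i\<in>I. x $ i ^ a i)"
proof (induction I rule: finite_induct)
  case (insert i I)
  have "poly_le m (\<lambda>x. x $ i ^ m)" for m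
  proof (induction m)
    case (Suc m)
    then show ?case
      using poly_le.coord[OF Suc, of i] by simp
  qed (simp add: poly_le.const)
  from poly_le_mult[OF this insert.IH] show ?case
    using insert.hyps by simp
qed (simp add: poly_le.const)

text \<open>With \<open>c = 1\<close> this turns the equations for the weights into reproduction of
  polynomials; with \<open>c = 0\<close> it turns a left kernel vector of the Vandermonde matrix
  into a functional that annihilates polynomials on the points.\<close>

lemma poly_le_functional:
  fixes z :: "'i \<Rightarrow> real^'d"
  assumes mon: "\<And>a. a \<in> multi_indices l \<Longrightarrow>
    (\<Sum>k\<in>K. w k * (\<Prod>i\<in>UNIV. z k $ i ^ a i)) = c * (\<Prod>i\<in>UNIV. y $ i ^ a i)"
  shows "poly_le m p \<Longrightarrow> m \<le> l \<Longrightarrow> (\<Sum>k\<in>K. w k * p (z k)) = c * p y"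
proof -
  \<comment> \<open>A spare monomial factor is carried along, so that the case \<open>coord\<close>
    can move its coordinate from the polynomial into the monomial.\<close>
  have "(\<Sum>k\<in>K. w k * ((\<Prod>i\<in>UNIV. z k $ i ^ a i) * p (z k))) = c * ((\<Prod>i\<in>UNIV. y $ i ^ a i) * p y)"
    if "poly_le m p" "(\<Sum>i\<in>UNIV. a i) + m \<le> l" for a
    using that
  proof (induction arbitrary: a rule: poly_le.induct)
    case (const m r)
    then have "(\<Sum>k\<in>K. w k * (\<Prod>i\<in>UNIV. z k $ i ^ a i)) = c * (\<Prod>i\<in>UNIV. y $ i ^ a i)"
      by (intro mon) (simp add: multi_indices_def)
    then have "(\<Sum>k\<in>K. w k * (\<Prod>i\<in>UNIV. z k $ i ^ a i)) * r = c * (\<Prod>i\<in>UNIV. y $ i ^ a i) * r"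
      by simp
    then show ?case
      by (simp add: sum_distrib_right mult.assoc)
  next
    case (add m p q)
    then show ?case
      by (simp add: distrib_left sum.distrib)
  next
    case (coord m p i)
    define a' where "a' = a(i := Suc (a i))"
    have eq: "(\<Prod>j\<in>UNIV. x $ j ^ a' j) = (\<Prod>j\<in>UNIV. x $ j ^ a j) * x $ i" for x :: "real^'d"
      by (simp add: a'_def prod.remove[of UNIV i] mult_ac)
    have "(\<Sum>j\<in>UNIV. a' j) = Suc (\<Sum>j\<in>UNIV. a j)"
      by (simp add: a'_def sum.remove[of UNIV i])
    then show ?case
      using coord.IH[of a'] coord.prems unfolding eq by (simp add: mult.assoc)
  qed
  from this[of "\<lambda>_. 0"] show "poly_le m p \<Longrightarrow> m \<le> l \<Longrightarrow> (\<Sum>k\<in>K. w k * p (z k)) = c * p y"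
    by simp
qed

section \<open>The Taylor polynomial and its remainder\<close>

text \<open>The sum stops before order \<open>b\<close>: the degree is then at most
  \<open>b - 1\<close>, which interpolation reproduces, and the derivative of order \<open>b\<close>
  is left to control the remainder.\<close>

definition taylor_poly :: "nat \<Rightarrow> (real^'d \<Rightarrow> real^'d) \<Rightarrow> real^'d \<Rightarrow> real^'d \<Rightarrow> real^'d" where
  "taylor_poly b f x y = (\<Sum>m<b. (1 / fact m) *\<^sub>R iter_deriv f (replicate m (y - x)) x)"

lemma taylor_poly_self:
  assumes "times_cont_diff b f" "b > 0"
  shows "taylor_poly b f x x = f x"
proof -
  have "iter_deriv f (replicate (Suc m) 0) x = 0" if "Suc m < b" for m
    using linear_0[OF iter_deriv_linear[OF assms(1), of "[]" "replicate m 0"]] that by simp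
  then have "(\<Sum>m<b. (1 / fact m) *\<^sub>R iter_deriv f (replicate m (0 :: real^'a)) x) =
      (\<Sum>m<b. if m = 0 then f x else 0)"
    by (intro sum.cong refl) (auto split: nat.split simp: gr0_conv_Suc)
  then show ?thesis
    using assms(2) by (simp add: taylor_poly_def)
qed

lemma poly_le_taylor_poly:
  assumes f: "times_cont_diff b f"
  shows "poly_le (b - 1) (\<lambda>y. taylor_poly b f x y $ j)"
proof -
  \<comment> \<open>The slots in \<open>ws\<close> are already expanded. Expanding a further slot
    \<open>y - x\<close> along the standard basis contributes a factor \<open>y $ i - x $ i\<close>
    and raises the degree by one.\<close>
  have *: "length ws + m \<le> b \<Longrightarrow> poly_le m (\<lambda>y. iter_deriv f (replicate m (y - x) @ ws) x $ j)" for m ws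
  proof (induction m arbitrary: ws)
    case 0
    then show ?case by (simp add: poly_le.const)
  next
    case (Suc m)
    have "poly_le (Suc m) (\<lambda>y. \<Sum>i\<in>UNIV. (1 * y $ i + - x $ i) *
        iter_deriv f (replicate m (y - x) @ axis i 1 # ws) x $ j)"
      using Suc.prems by (intro poly_le_sum poly_le_affine_coord Suc.IH) simp
    also have "(\<lambda>y. \<Sum>i\<in>UNIV. (1 * y $ i + - x $ i) *
        iter_deriv f (replicate m (y - x) @ axis i 1 # ws) x $ j) =
        (\<lambda>y. iter_deriv f (replicate (Suc m) (y - x) @ ws) x $ j)"
    proof
      fix y
      have lin: "linear (\<lambda>v. iter_deriv f (replicate m (y - x) @ v # ws) x)"
        using Suc.prems by (intro iter_deriv_linear[OF f]) simp
      have "iter_deriv f (replicate m (y - x) @ (\<Sum>i\<in>UNIV. (y - x) $ i *\<^sub>R axis i 1) # ws) x =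
          (\<Sum>i\<in>UNIV. (y - x) $ i *\<^sub>R iter_deriv f (replicate m (y - x) @ axis i 1 # ws) x)"
        by (simp only: linear_sum[OF lin] linear_scale[OF lin])
      then have "iter_deriv f (replicate m (y - x) @ (y - x) # ws) x =
          (\<Sum>i\<in>UNIV. (y - x) $ i *\<^sub>R iter_deriv f (replicate m (y - x) @ axis i 1 # ws) x)"
        using basis_expansion[of "y - x"] by (simp add: scalar_mult_eq_scaleR)
      then show "(\<Sum>i\<in>UNIV. (1 * y $ i + - x $ i) *
          iter_deriv f (replicate m (y - x) @ axis i 1 # ws) x $ j) =
          iter_deriv f (replicate (Suc m) (y - x) @ ws) x $ j"
        by (simp only: replicate_Suc replicate_append_same[symmetric] append_assoc append_Cons append_Nil) simp
    qed
    finally show ?case .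
  qed
  have "poly_le (b - 1) (\<lambda>y. \<Sum>m<b. (1 / fact m) * iter_deriv f (replicate m (y - x) @ []) x $ j)"
  proof (intro poly_le_sum poly_le_cmult)
    fix m assume "m \<in> {..<b}"
    then show "poly_le (b - 1) (\<lambda>y. iter_deriv f (replicate m (y - x) @ []) x $ j)"
      by (intro poly_le_mono[OF *]) auto
  qed
  then show ?thesis
    by (simp add: taylor_poly_def)
qed

text \<open>The one-dimensional Maclaurin formula is used on the segment from \<open>x\<close> to
  \<open>y\<close>, for a single component because the intermediate point depends on it. The factor
  \<open>1 / fact b\<close> is discarded.\<close>

lemma taylor_poly_remainder:
  assumes f: "f \<in> F_class b Ls" and Ls: "\<And>k. k \<le> b \<Longrightarrow> Ls k \<ge> 0" and b: "b > 0"
  shows "\<bar>f y $ j - taylor_poly b f x y $ j\<bar> \<le> Ls b * norm (y - x) ^ b"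
proof -
  define h where "h = y - x"
  let ?diff = "\<lambda>m t. iter_deriv f (replicate m h) (x + t *\<^sub>R h) $ j"
  have "(?diff m has_field_derivative ?diff (Suc m) t) (at t)" if "m < b" for m t
  proof -
    have "((\<lambda>r. x + r *\<^sub>R h) has_vector_derivative h) (at t)"
      by (auto intro!: derivative_eq_intros simp: has_vector_derivative_def)
    from iter_deriv_has_vector_derivative[OF F_class_times_cont_diff[OF f] this, of "[]" "[]" "replicate m h"]
    have "((\<lambda>r. iter_deriv f (replicate m h) (x + r *\<^sub>R h)) has_vector_derivative
        iter_deriv f (replicate (Suc m) h) (x + t *\<^sub>R h)) (at t)"
      using that by simp
    from bounded_linear.has_vector_derivative[OF bounded_linear_vec_nth this] show ?thesis
      unfolding has_real_derivative_iff_has_vector_derivative .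
  qed
  then obtain t where "?diff 0 1 = (\<Sum>m<b. ?diff m 0 / fact m * 1 ^ m) + ?diff b t / fact b * 1 ^ b"
    using Maclaurin[of 1 b ?diff "?diff 0"] b by auto
  then have "f y $ j - taylor_poly b f x y $ j = ?diff b t / fact b"
    by (simp add: taylor_poly_def h_def)
  also have "\<bar>\<dots>\<bar> \<le> \<bar>?diff b t\<bar>"
    by (simp add: divide_le_eq abs_mult mult_le_cancel_left1)
  also have "\<dots> \<le> norm (iter_deriv f (replicate b h) (x + t *\<^sub>R h))"
    by (rule component_le_norm_cart)
  also have "\<dots> \<le> Ls b * norm h ^ b"
    using F_class_norm_iter_deriv[OF f Ls, of "replicate b h"] by simp
  finally show ?thesis by (simp add: h_def)
qed

section \<open>Interpolation\<close>

lemma matrix_inv_cancel: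
  fixes A :: "real^'n^'n"
  assumes "invertible A"
  shows "A ** matrix_inv A = mat 1" "matrix_inv A ** A = mat 1"
  using someI_ex[of "\<lambda>B. A ** B = mat 1 \<and> B ** A = mat 1"] assms
  by (auto simp: matrix_inv_def invertible_def)

lemma norm_matrix_inv_mult_le: "norm (matrix_inv A *v v) \<le> inv_opnorm A * norm v"
  unfolding inv_opnorm_def by (rule onorm) (simp add: linear_conv_bounded_linear[symmetric])

lemma inv_opnorm_nonneg: "inv_opnorm A \<ge> 0"
  unfolding inv_opnorm_def by (rule onorm_pos_le) (simp add: linear_conv_bounded_linear[symmetric])

text \<open>Both claims follow from the lower bound \<open>key\<close>, which makes
  \<open>A'\<close> injective and bounds its inverse. The factor \<open>CARD('n)\<close> appears
  twice because the norm of \<open>A' - A\<close> is estimated by summing entries over rows and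
  columns.\<close>

lemma inv_opnorm_perturb:
  fixes A A' :: "real^'n^'n"
  assumes inv: "invertible A" and s: "inv_opnorm A \<le> s"
    and e: "\<And>i j. \<bar>A' $ i $ j - A $ i $ j\<bar> \<le> e"
    and small: "s * (real CARD('n) * real CARD('n) * e) \<le> 1 / 2"
  shows "invertible A'" "inv_opnorm A' \<le> 2 * s"
proof -
  let ?n = "real CARD('n)"
  have s0: "s \<ge> 0" using inv_opnorm_nonneg[of A] s by simp
  have key: "norm v \<le> 2 * s * norm (A' *v v)" for v
  proof -
    have "\<bar>((A' - A) *v v) $ i\<bar> \<le> ?n * (e * norm v)" for i
    proof -
      have "\<bar>((A' - A) *v v) $ i\<bar> \<le> (\<Sum>j\<in>UNIV. \<bar>(A' $ i $ j - A $ i $ j) * v $ j\<bar>)"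
        unfolding matrix_vector_mult_def by (simp add: sum_abs)
      also have "\<dots> \<le> (\<Sum>j\<in>(UNIV :: 'n set). e * norm v)"
        unfolding abs_mult by (intro sum_mono mult_mono e component_le_norm_cart order_trans[OF abs_ge_zero e]) auto
      finally show ?thesis by simp
    qed
    then have "(\<Sum>i\<in>UNIV. \<bar>((A' - A) *v v) $ i\<bar>) \<le> (\<Sum>i\<in>(UNIV :: 'n set). ?n * (e * norm v))"
      by (intro sum_mono)
    then have *: "norm ((A' - A) *v v) \<le> ?n * ?n * e * norm v"
      using norm_le_l1_cart[of "(A' - A) *v v"] by simp
    have "v = matrix_inv A *v (A *v v)"
      by (simp add: matrix_vector_mul_assoc matrix_inv_cancel[OF inv])
    then have "norm v \<le> inv_opnorm A * norm (A *v v)"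
      by (metis norm_matrix_inv_mult_le)
    also have "\<dots> \<le> s * norm (A *v v)"
      by (intro mult_right_mono s) simp
    also have "A *v v = A' *v v - (A' - A) *v v"
      by (simp add: matrix_vector_mult_diff_rdistrib)
    also have "norm \<dots> \<le> norm (A' *v v) + ?n * ?n * e * norm v"
      using * norm_triangle_ineq4[of "A' *v v" "(A' - A) *v v"] by linarith
    finally have "norm v \<le> s * norm (A' *v v) + s * (?n * ?n * e) * norm v"
      using s0 by (simp add: distrib_left mult_left_mono mult.assoc)
    \<comment> \<open>The smallness hypothesis makes the perturbation cost at most half of
      \<open>norm v\<close>, which is absorbed on the left.\<close>
    also have "\<dots> \<le> s * norm (A' *v v) + 1 / 2 * norm v"
      using mult_right_mono[OF small norm_ge_zero[of v]] by simp
    finally show ?thesis by simp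
  qed
  have "\<forall>v. A' *v v = 0 \<longrightarrow> v = 0"
    using key by (metis mult_zero_right norm_le_zero_iff norm_zero)
  then show inv': "invertible A'"
    using matrix_left_invertible_ker invertible_left_inverse by blast
  show "inv_opnorm A' \<le> 2 * s"
    unfolding inv_opnorm_def
  proof (rule onorm_le)
    fix v show "norm (matrix_inv A' *v v) \<le> 2 * s * norm v"
      using key[of "matrix_inv A' *v v"]
      by (simp add: matrix_vector_mul_assoc matrix_inv_cancel[OF inv'])
  qed
qed

section \<open>Normalised interpolation points\<close>

lemma norm_entries_diff_le: "norm (xs $ j - xs $ k) \<le> diameter (entries xs)"
  using diameter_bounded_bound[of "entries xs" "xs $ j" "xs $ k"]
  by (simp add: entries_def finite_imp_bounded dist_norm)

lemma norm_hull_entries_diff_le: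
  assumes "x \<in> convex hull (entries xs)"
  shows "norm (x - xs $ k) \<le> diameter (entries xs)"
proof -
  have "convex hull (entries xs) \<subseteq> cball (xs $ k) (diameter (entries xs))"
    by (rule hull_minimal) (auto simp: entries_def dist_norm norm_entries_diff_le[unfolded entries_def])
  with assms show ?thesis
    by (auto simp: dist_norm norm_minus_commute)
qed

lemma eta_scaled:
  fixes xs :: "real^'d^'N"
  assumes "diameter (entries xs) > 0"
  shows "diameter (entries xs) *\<^sub>R eta xs x = x - (\<Sum>k\<in>UNIV. xs $ k) /\<^sub>R real CARD('N)"
  using assms by (simp add: eta_def)

text \<open>Before division by the diameter, \<open>eta xs x\<close> is the mean of the differences
  \<open>x - xs $ k\<close>, each of which is at most the diameter.\<close>

lemma norm_eta_hull_le:
  fixes xs :: "real^'d^'N"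
  assumes d: "diameter (entries xs) > 0" and x: "x \<in> convex hull (entries xs)"
  shows "norm (eta xs x) \<le> 1"
proof -
  let ?d = "diameter (entries xs)"
  have "?d *\<^sub>R eta xs x = (\<Sum>k\<in>UNIV. x - xs $ k) /\<^sub>R real CARD('N)"
    by (simp add: eta_scaled[OF d] sum_subtractf scaleR_right_diff_distrib sum_constant_scaleR
        del: sum_constant)
  moreover have "norm (\<Sum>k\<in>UNIV. x - xs $ k) \<le> (\<Sum>k\<in>(UNIV :: 'N set). ?d)"
    by (intro sum_norm_le norm_hull_entries_diff_le x)
  ultimately have "norm (?d *\<^sub>R eta xs x) \<le> ?d"
    by (simp add: field_simps)
  then show ?thesis
    using d by simp
qed

lemma psi_le_1:
  assumes "norm z \<le> 1"
  shows "\<bar>psi \<alpha> z $ j\<bar> \<le> 1"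
proof -
  have "\<bar>z $ i\<bar> ^ \<alpha> j i \<le> 1" for i
    using component_le_norm_cart[of z i] assms by (intro power_le_one) auto
  then show ?thesis
    by (auto simp: psi_def abs_prod power_abs intro!: prod_le_1)
qed

text \<open>Factors bounded by 1 allow a difference of products to be estimated by the sum of the
  differences of the factors; the factor \<open>l\<close> is the bound on the sum of the
  exponents.\<close>

lemma psi_diff_le:
  assumes z: "norm z \<le> 1" "norm z' \<le> 1" and \<alpha>: "\<alpha> j \<in> multi_indices l"
  shows "\<bar>psi \<alpha> z $ j - psi \<alpha> z' $ j\<bar> \<le> real l * norm (z - z')"
proof -
  have le1: "norm (z $ i) \<le> 1" "norm (z' $ i) \<le> 1" for i
    using component_le_norm_cart[of z i] component_le_norm_cart[of z' i] z by auto
  have "\<bar>psi \<alpha> z $ j - psi \<alpha> z' $ j\<bar> \<le> (\<Sum>i\<in>UNIV. norm (z $ i ^ \<alpha> j i - z' $ i ^ \<alpha> j i))"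
    unfolding psi_def using le1
    by (auto simp flip: real_norm_def simp: norm_power intro!: norm_prod_diff power_le_one)
  also have "\<dots> \<le> (\<Sum>i\<in>UNIV. real (\<alpha> j i) * norm (z - z'))"
  proof (rule sum_mono)
    fix i
    have "norm (z $ i ^ \<alpha> j i - z' $ i ^ \<alpha> j i) \<le> real (\<alpha> j i) * norm (z $ i - z' $ i)"
      by (intro norm_power_diff le1)
    also have "\<dots> \<le> real (\<alpha> j i) * norm (z - z')"
      using component_le_norm_cart[of "z - z'" i] by (intro mult_left_mono) auto
    finally show "norm (z $ i ^ \<alpha> j i - z' $ i ^ \<alpha> j i) \<le> real (\<alpha> j i) * norm (z - z')" .
  qed
  also have "\<dots> = real (\<Sum>i\<in>UNIV. \<alpha> j i) * norm (z - z')"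
    by (simp add: sum_distrib_right)
  also have "\<dots> \<le> real l * norm (z - z')"
    using \<alpha> by (intro mult_right_mono) (auto simp: multi_indices_def simp del: of_nat_sum)
  finally show ?thesis .
qed

section \<open>Interpolation weights and the interpolation error\<close>

text \<open>The interpolant is built on the points themselves, whereas conditioning is measured on
  the normalised points. Reproduction of polynomials is invariant under affine maps, so weights
  defined on the normalised points serve for both.\<close>

lemma interpolation_weights:
  fixes \<alpha> :: "'N::finite \<Rightarrow> 'd::finite \<Rightarrow> nat"
  assumes \<alpha>: "bij_betw \<alpha> UNIV (multi_indices l)"
    and d: "diameter (entries xs) > 0" and inv: "invertible (Psi_eta \<alpha> xs)"
  obtains w where
    "\<And>m p. poly_le m p \<Longrightarrow> m \<le> l \<Longrightarrow> (\<Sum>k\<in>UNIV. w $ k * p (xs $ k)) = p x"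
    "\<And>ys. interpolant \<alpha> xs ys x = (\<Sum>k\<in>UNIV. w $ k *\<^sub>R ys $ k)"
    "\<And>k. \<bar>w $ k\<bar> \<le> norm (psi \<alpha> (eta xs x)) * inv_opnorm (Psi_eta \<alpha> xs)"
proof
  let ?d = "diameter (entries xs)"
  let ?c = "(\<Sum>k\<in>UNIV. xs $ k) /\<^sub>R real CARD('N)"
  define w where "w = psi \<alpha> (eta xs x) v* matrix_inv (Psi_eta \<alpha> xs)"
  have w: "w v* Psi_eta \<alpha> xs = psi \<alpha> (eta xs x)"
    by (simp add: w_def vector_matrix_mul_assoc matrix_inv_cancel[OF inv])
  have mult_Psi: "(v v* Psi \<alpha> zs) $ j = (\<Sum>k\<in>UNIV. v $ k * (\<Prod>i\<in>UNIV. zs $ k $ i ^ \<alpha> j i))" for v zs j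
    by (simp add: vector_matrix_mult_def Psi_def psi_def)
  have all_indices: "(\<And>j. P (\<alpha> j)) \<Longrightarrow> a \<in> multi_indices l \<Longrightarrow> P a" for P a
    using bij_betw_imp_surj_on[OF \<alpha>] by (metis rangeE)
  show reproduce: "(\<Sum>k\<in>UNIV. w $ k * p (xs $ k)) = p x" if "poly_le m p" "m \<le> l" for m p
  proof -
    have "(\<Sum>k\<in>UNIV. w $ k * p (?d *\<^sub>R eta xs (xs $ k) + ?c)) = 1 * p (?d *\<^sub>R eta xs x + ?c)"
    proof (rule poly_le_functional[OF _ poly_le_affine[OF that(1)] that(2)])
      fix a :: "'d \<Rightarrow> nat" assume "a \<in> multi_indices l"
      then show "(\<Sum>k\<in>UNIV. w $ k * (\<Prod>i\<in>UNIV. eta xs (xs $ k) $ i ^ a i)) =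
          1 * (\<Prod>i\<in>UNIV. eta xs x $ i ^ a i)"
      proof (rule all_indices[rotated])
        fix j
        show "(\<Sum>k\<in>UNIV. w $ k * (\<Prod>i\<in>UNIV. eta xs (xs $ k) $ i ^ \<alpha> j i)) =
          1 * (\<Prod>i\<in>UNIV. eta xs x $ i ^ \<alpha> j i)"
          using mult_Psi[of w "\<chi> k. eta xs (xs $ k)" j] w by (simp add: Psi_eta_def psi_def)
      qed
    qed
    then show ?thesis
      by (simp add: eta_scaled[OF d])
  qed
  have mono: "poly_le l (\<lambda>y. \<Prod>i\<in>UNIV. y $ i ^ \<alpha> j i)" for j
  proof (rule poly_le_mono[OF poly_le_monomial])
    show "(\<Sum>i\<in>UNIV. \<alpha> j i) \<le> l"
      using bij_betw_imp_surj_on[OF \<alpha>] by (auto simp: multi_indices_def)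
  qed simp
  have w_Psi: "w v* Psi \<alpha> xs = psi \<alpha> x"
    using reproduce[OF mono] by (simp add: vec_eq_iff mult_Psi psi_def)
  \<comment> \<open>A left kernel vector of \<open>Psi \<alpha> xs\<close> annihilates every
    polynomial of degree at most \<open>l\<close> on the points, in particular the monomials in
    normalised coordinates. It is thus a left kernel vector of the invertible
    \<open>Psi_eta \<alpha> xs\<close>.\<close>
  have "v = 0" if v: "v v* Psi \<alpha> xs = 0" for v
  proof -
    have eta_eq: "eta xs z = (1 / ?d) *\<^sub>R z + (- (1 / ?d) *\<^sub>R ?c)" for z
      by (simp add: eta_def inverse_eq_divide scaleR_right_diff_distrib)
    have "(\<Sum>k\<in>UNIV. v $ k * (\<Prod>i\<in>UNIV. eta xs (xs $ k) $ i ^ \<alpha> j i)) = 0 *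
        (\<Prod>i\<in>UNIV. eta xs x $ i ^ \<alpha> j i)" for j
    proof (rule poly_le_functional[where l = l and m = l and p = "\<lambda>y. \<Prod>i\<in>UNIV. eta xs y $ i ^ \<alpha> j i"])
      fix a :: "'d \<Rightarrow> nat" assume "a \<in> multi_indices l"
      then show "(\<Sum>k\<in>UNIV. v $ k * (\<Prod>i\<in>UNIV. xs $ k $ i ^ a i)) = 0 * (\<Prod>i\<in>UNIV. x $ i ^ a i)"
      proof (rule all_indices[rotated])
        fix j
        show "(\<Sum>k\<in>UNIV. v $ k * (\<Prod>i\<in>UNIV. xs $ k $ i ^ \<alpha> j i)) = 0 * (\<Prod>i\<in>UNIV. x $ i ^ \<alpha> j i)"
          using mult_Psi[of v xs j] v by simp
      qed
    next
      show "poly_le l (\<lambda>y. \<Prod>i\<in>UNIV. eta xs y $ i ^ \<alpha> j i)"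
        unfolding eta_eq by (rule poly_le_affine[OF mono])
    qed simp
    then have "v v* Psi_eta \<alpha> xs = 0"
      by (simp add: vec_eq_iff mult_Psi Psi_eta_def)
    then have "v v* (Psi_eta \<alpha> xs ** matrix_inv (Psi_eta \<alpha> xs)) = 0"
      by (simp flip: vector_matrix_mul_assoc)
    then show ?thesis
      by (simp add: matrix_inv_cancel[OF inv])
  qed
  then have "\<exists>B. B ** transpose (Psi \<alpha> xs) = mat 1"
    unfolding matrix_left_invertible_ker by simp
  then have inv_Psi: "invertible (Psi \<alpha> xs)"
    by (metis invertible_left_inverse transpose_invertible transpose_transpose)
  show "interpolant \<alpha> xs ys x = (\<Sum>k\<in>UNIV. w $ k *\<^sub>R ys $ k)" for ys
  proof -
    have "interpolant \<alpha> xs ys x = w v* (Psi \<alpha> xs ** (matrix_inv (Psi \<alpha> xs) ** ys))"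
      using inv_Psi by (simp add: interpolant_def w_Psi[symmetric] vector_matrix_mul_assoc)
    also have "\<dots> = w v* ys"
      by (simp add: matrix_mul_assoc matrix_inv_cancel[OF inv_Psi])
    finally show ?thesis
      by (simp add: vec_eq_iff vector_matrix_mult_def)
  qed
  show "\<bar>w $ k\<bar> \<le> norm (psi \<alpha> (eta xs x)) * inv_opnorm (Psi_eta \<alpha> xs)" for k
  proof -
    \<comment> \<open>Moving the inverse to the other side of the inner product expresses
      \<open>w $ k\<close> through a column of the inverse, whose norm is at most
      \<open>inv_opnorm\<close>.\<close>
    have "w $ k = w \<bullet> axis k 1"
      by (simp add: inner_axis)
    also have "\<dots> = psi \<alpha> (eta xs x) \<bullet> (matrix_inv (Psi_eta \<alpha> xs) *v axis k 1)"
      by (simp add: w_def dot_lmul_matrix)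
    also have "\<bar>\<dots>\<bar> \<le> norm (psi \<alpha> (eta xs x)) * norm (matrix_inv (Psi_eta \<alpha> xs) *v axis k 1)"
      by (rule Cauchy_Schwarz_ineq2)
    also have "\<dots> \<le> norm (psi \<alpha> (eta xs x)) * inv_opnorm (Psi_eta \<alpha> xs)"
      using norm_matrix_inv_mult_le[of "Psi_eta \<alpha> xs" "axis k 1"] by (intro mult_left_mono) auto
    finally show ?thesis .
  qed
qed

text \<open>The weights reproduce the Taylor polynomial of \<open>f\<close> at \<open>x\<close>,
  whose value there is \<open>f x\<close>, so only the data errors and the remainders at the points
  survive. The condition number stays a factor instead of being replaced by \<open>S\<close>: its
  product with the power of the diameter is the \<open>objective\<close>.\<close>

lemma interpolation_error:
  fixes \<alpha> :: "'N::finite \<Rightarrow> 'd::finite \<Rightarrow> nat" and f :: "real^'d \<Rightarrow> real^'d"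
  assumes \<alpha>: "bij_betw \<alpha> UNIV (multi_indices l)" and b: "b = Suc l"
    and f: "f \<in> F_class b Ls" and Ls: "\<And>k. k \<le> b \<Longrightarrow> Ls k \<ge> 0"
    and xs: "xs \<in> H_set \<alpha> S 0 X x" and E: "\<And>k. norm (ys $ k - f (xs $ k)) \<le> E"
  shows "norm (interpolant \<alpha> xs ys x - f x) \<le> real CARD('d) * real CARD('N) ^ 2 *
    (inv_opnorm (Psi_eta \<alpha> xs) * (E + Ls b * diameter (entries xs) ^ b))"
proof -
  let ?d = "diameter (entries xs)" and ?N = "real CARD('N)"
  let ?I = "inv_opnorm (Psi_eta \<alpha> xs)"
  have d: "?d > 0" and inv: "invertible (Psi_eta \<alpha> xs)" and hull: "x \<in> convex hull (entries xs)"
    using xs by (simp_all add: H_set_def ch_mu_def)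
  obtain w where w: "\<And>m p. poly_le m p \<Longrightarrow> m \<le> l \<Longrightarrow> (\<Sum>k\<in>UNIV. w $ k * p (xs $ k)) = p x"
    "interpolant \<alpha> xs ys x = (\<Sum>k\<in>UNIV. w $ k *\<^sub>R ys $ k)"
    "\<And>k. \<bar>w $ k\<bar> \<le> norm (psi \<alpha> (eta xs x)) * ?I"
    by (rule interpolation_weights[OF \<alpha> d inv, of x]) blast
  have "norm (psi \<alpha> (eta xs x)) \<le> (\<Sum>j\<in>UNIV. \<bar>psi \<alpha> (eta xs x) $ j\<bar>)"
    by (rule norm_le_l1_cart)
  also have "\<dots> \<le> (\<Sum>j\<in>(UNIV :: 'N set). 1)"
    by (intro sum_mono psi_le_1 norm_eta_hull_le d hull)
  finally have "norm (psi \<alpha> (eta xs x)) \<le> ?N"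
    by simp
  then have w_le: "\<bar>w $ k\<bar> \<le> ?N * ?I" for k
    using w(3)[of k] mult_right_mono[OF _ inv_opnorm_nonneg] by (meson order_trans)
  have comp: "\<bar>(interpolant \<alpha> xs ys x - f x) $ j\<bar> \<le> ?N ^ 2 * (?I * (E + Ls b * ?d ^ b))" for j
  proof -
    let ?P = "\<lambda>y. taylor_poly b f x y $ j"
    have "f x $ j = (\<Sum>k\<in>UNIV. w $ k * ?P (xs $ k))"
      using w(1)[OF poly_le_taylor_poly[OF F_class_times_cont_diff[OF f], of x j]] b
        taylor_poly_self[OF F_class_times_cont_diff[OF f], of x] by simp
    then have "(interpolant \<alpha> xs ys x - f x) $ j = (\<Sum>k\<in>UNIV. w $ k * (ys $ k $ j - ?P (xs $ k)))"
      by (simp add: w(2) right_diff_distrib sum_subtractf)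
    also have "\<bar>\<dots>\<bar> \<le> (\<Sum>k\<in>UNIV. \<bar>w $ k\<bar> * \<bar>ys $ k $ j - ?P (xs $ k)\<bar>)"
      unfolding abs_mult[symmetric] by (rule sum_abs)
    also have "\<dots> \<le> (\<Sum>k\<in>(UNIV :: 'N set). (?N * ?I) * (E + Ls b * ?d ^ b))"
    proof (intro sum_mono mult_mono w_le)
      fix k
      have "\<bar>ys $ k $ j - f (xs $ k) $ j\<bar> \<le> E"
        using component_le_norm_cart[of "ys $ k - f (xs $ k)" j] E[of k] by simp
      moreover have "\<bar>f (xs $ k) $ j - ?P (xs $ k)\<bar> \<le> Ls b * norm (xs $ k - x) ^ b"
        using b by (intro taylor_poly_remainder[OF f Ls]) auto
      moreover have "Ls b * norm (xs $ k - x) ^ b \<le> Ls b * ?d ^ b"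
        using norm_hull_entries_diff_le[OF hull, of k] Ls
        by (intro mult_left_mono power_mono) (auto simp: norm_minus_commute)
      ultimately show "\<bar>ys $ k $ j - ?P (xs $ k)\<bar> \<le> E + Ls b * ?d ^ b"
        by linarith
    qed (auto simp: inv_opnorm_nonneg)
    finally show ?thesis
      by (simp add: power2_eq_square mult.assoc)
  qed
  have "norm (interpolant \<alpha> xs ys x - f x) \<le> (\<Sum>j\<in>UNIV. \<bar>(interpolant \<alpha> xs ys x - f x) $ j\<bar>)"
    by (rule norm_le_l1_cart)
  also have "\<dots> \<le> (\<Sum>j\<in>(UNIV :: 'd set). ?N ^ 2 * (?I * (E + Ls b * ?d ^ b)))"
    by (intro sum_mono comp)
  finally show ?thesis
    by (simp add: mult.assoc)
qed

section \<open>Stability of well-conditioned tuples\<close>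

text \<open>If \<open>x\<close> were outside, a hyperplane with normal \<open>a\<close> would
  separate it strictly from the moved points and, after a shift by \<open>norm a * \<rho>\<close>,
  bound the original points from the same side. The point at distance \<open>r\<close> from
  \<open>x\<close> against \<open>a\<close> lies in the original hull, yet beyond the shifted
  hyperplane because \<open>\<rho> \<le> r\<close>.\<close>

lemma hull_perturb:
  fixes xs zs :: "real^'d^'N"
  assumes x: "cball x r \<subseteq> convex hull (entries xs)" and r: "\<rho> \<le> r" "r \<ge> 0"
    and \<rho>: "\<And>k. norm (zs $ k - xs $ k) \<le> \<rho>"
  shows "x \<in> convex hull (entries zs)"
proof (rule ccontr)
  assume "x \<notin> convex hull (entries zs)"
  moreover have "closed (convex hull (entries zs))"
    by (intro compact_imp_closed compact_convex_hull finite_imp_compact) (simp add: entries_def)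
  ultimately obtain a c where a: "a \<bullet> x < c" "\<And>y. y \<in> convex hull (entries zs) \<Longrightarrow> a \<bullet> y > c"
    using separating_hyperplane_closed_point[of "convex hull (entries zs)" x] convex_convex_hull by blast
  have "a \<noteq> 0"
  proof
    assume "a = 0"
    then show False
      using a(1) a(2)[of "zs $ undefined"] by (simp add: hull_inc entries_def)
  qed
  define y where "y = x - r *\<^sub>R sgn a"
  have "y \<in> cball x r"
    using r \<open>a \<noteq> 0\<close> by (simp add: y_def dist_norm norm_sgn)
  then have "y \<in> convex hull (entries xs)"
    using x by blast
  moreover have "convex hull (entries xs) \<subseteq> {y. a \<bullet> y \<ge> c - norm a * \<rho>}"
  proof (rule hull_minimal)
    show "entries xs \<subseteq> {y. a \<bullet> y \<ge> c - norm a * \<rho>}"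
    proof
      fix y assume "y \<in> entries xs"
      then obtain k where k: "y = xs $ k" by (auto simp: entries_def)
      have "a \<bullet> (zs $ k) > c"
        by (intro a(2) hull_inc) (simp add: entries_def)
      moreover have "a \<bullet> (zs $ k - xs $ k) \<le> norm a * \<rho>"
        using norm_cauchy_schwarz[of a "zs $ k - xs $ k"] mult_left_mono[OF \<rho>[of k] norm_ge_zero[of a]]
        by linarith
      ultimately show "y \<in> {y. a \<bullet> y \<ge> c - norm a * \<rho>}"
        by (simp add: k inner_diff_right)
    qed
  qed (rule convex_halfspace_ge)
  ultimately have "a \<bullet> x - r * (a \<bullet> sgn a) \<ge> c - norm a * \<rho>"
    by (auto simp: y_def inner_diff_right)
  moreover have "a \<bullet> sgn a = norm a"
    using \<open>a \<noteq> 0\<close> by (simp add: sgn_div_norm dot_square_norm power2_eq_square)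
  moreover have "norm a * \<rho> \<le> r * norm a"
    using mult_left_mono[OF r(1) norm_ge_zero[of a]] by (simp add: mult.commute)
  ultimately show False
    using a(1) by simp
qed

lemma diameter_entries_le:
  fixes xs zs :: "real^'d^'N"
  assumes \<rho>: "\<And>k. norm (zs $ k - xs $ k) \<le> \<rho>"
  shows "diameter (entries zs) \<le> diameter (entries xs) + 2 * \<rho>"
proof (rule diameter_le)
  fix x y assume "x \<in> entries zs" "y \<in> entries zs"
  then obtain j k where jk: "x = zs $ j" "y = zs $ k"
    by (auto simp: entries_def)
  have "x - y = (zs $ j - xs $ j) + (xs $ j - xs $ k) - (zs $ k - xs $ k)"
    by (simp add: jk)
  then have "norm (x - y) \<le> norm (zs $ j - xs $ j) + norm (xs $ j - xs $ k) + norm (zs $ k - xs $ k)"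
    by (smt (verit) norm_triangle_ineq norm_triangle_ineq4)
  then show "norm (x - y) \<le> diameter (entries xs) + 2 * \<rho>"
    using \<rho>[of j] \<rho>[of k] norm_entries_diff_le[of xs j k] by linarith
qed (simp add: entries_def)

text \<open>Half of the bound comes from the moves of the point and of the mean, at most
  \<open>\<rho>\<close> each. The other half comes from the change of the diameter by at most
  \<open>2 * \<rho>\<close>, multiplied by a normalised point of norm at most 1.\<close>

lemma norm_eta_diff_le:
  fixes xs zs :: "real^'d^'N"
  assumes \<rho>: "\<And>k. norm (zs $ k - xs $ k) \<le> \<rho>"
    and d: "diameter (entries xs) > 0" "diameter (entries zs) > 0"
  shows "norm (eta zs (zs $ k) - eta xs (xs $ k)) \<le> 4 * \<rho> / diameter (entries xs)"
proof -
  let ?d = "diameter (entries xs)" and ?d' = "diameter (entries zs)"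
  let ?c = "(\<Sum>k\<in>UNIV. xs $ k) /\<^sub>R real CARD('N)" and ?c' = "(\<Sum>k\<in>UNIV. zs $ k) /\<^sub>R real CARD('N)"
  have "norm (\<Sum>k\<in>UNIV. zs $ k - xs $ k) \<le> (\<Sum>k\<in>(UNIV :: 'N set). \<rho>)"
    by (intro sum_norm_le \<rho>)
  moreover have "?c' - ?c = (\<Sum>k\<in>UNIV. zs $ k - xs $ k) /\<^sub>R real CARD('N)"
    by (simp add: sum_subtractf scaleR_right_diff_distrib)
  ultimately have c: "norm (?c' - ?c) \<le> \<rho>"
    by (simp add: inverse_eq_divide pos_divide_le_eq mult.commute)
  have "norm ((zs $ k - ?c') - (xs $ k - ?c)) \<le> 2 * \<rho>"
    using norm_triangle_ineq4[of "zs $ k - xs $ k" "?c' - ?c"] c \<rho>[of k] by (simp add: algebra_simps)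
  then have 1: "norm (?d' *\<^sub>R eta zs (zs $ k) - ?d *\<^sub>R eta xs (xs $ k)) \<le> 2 * \<rho>"
    by (simp add: eta_scaled d)
  have "norm (xs $ k - zs $ k) \<le> \<rho>" for k
    using \<rho>[of k] by (simp add: norm_minus_commute)
  then have "\<bar>?d' - ?d\<bar> \<le> 2 * \<rho>"
    using diameter_entries_le[of zs xs \<rho>] diameter_entries_le[of xs zs \<rho>] \<rho> by (simp add: abs_le_iff)
  moreover have "norm (eta zs (zs $ k)) \<le> 1"
    by (intro norm_eta_hull_le d hull_inc) (simp add: entries_def)
  ultimately have 2: "norm ((?d' - ?d) *\<^sub>R eta zs (zs $ k)) \<le> 2 * \<rho>"
    by (metis abs_ge_zero dual_order.trans mult_left_le norm_scaleR)
  have "?d * norm (eta zs (zs $ k) - eta xs (xs $ k)) = norm (?d *\<^sub>R (eta zs (zs $ k) - eta xs (xs $ k)))"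
    using d by simp
  also have "?d *\<^sub>R (eta zs (zs $ k) - eta xs (xs $ k)) =
      (?d' *\<^sub>R eta zs (zs $ k) - ?d *\<^sub>R eta xs (xs $ k)) - (?d' - ?d) *\<^sub>R eta zs (zs $ k)"
    by (simp add: algebra_simps)
  also have "norm \<dots> \<le> 4 * \<rho>"
    using 1 2 norm_triangle_ineq4 by (smt (verit))
  finally show ?thesis
    using d by (simp add: field_simps)
qed

text \<open>The smallness conditions serve one purpose each: \<open>x\<close> stays in the hull, the
  diameter stays positive and at most doubles, and the bound on the condition number at most
  doubles. The margin \<open>\<mu>\<close> may be used up, hence the index 0 in the
  conclusion.\<close>

lemma H_set_perturb:
  fixes \<alpha> :: "'N::finite \<Rightarrow> 'd::finite \<Rightarrow> nat"
  assumes \<alpha>: "bij_betw \<alpha> UNIV (multi_indices l)" and \<mu>: "\<mu> \<ge> 0"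
    and xs: "xs \<in> H_set \<alpha> s \<mu> X x" and zs: "entries zs \<subseteq> Z"
    and \<rho>: "\<And>k. norm (zs $ k - xs $ k) \<le> \<rho>"
    and small: "\<rho> \<le> \<mu> * diameter (entries xs)" "4 * \<rho> \<le> diameter (entries xs)"
      "8 * s * real CARD('N) ^ 2 * real l * \<rho> \<le> diameter (entries xs)"
  shows "zs \<in> H_set \<alpha> (2 * s) 0 Z x" "diameter (entries zs) \<le> 2 * diameter (entries xs)"
proof -
  let ?d = "diameter (entries xs)" and ?d' = "diameter (entries zs)"
  have d: "?d > 0" and inv: "invertible (Psi_eta \<alpha> xs)" "inv_opnorm (Psi_eta \<alpha> xs) \<le> s"
    and hull: "cball x (\<mu> * ?d) \<subseteq> convex hull (entries xs)"
    using xs by (auto simp: H_set_def ch_mu_def)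
  have "norm (xs $ k - zs $ k) \<le> \<rho>" for k
    using \<rho>[of k] by (simp add: norm_minus_commute)
  then have d': "?d' > 0"
    using diameter_entries_le[of xs zs \<rho>] small(2) d by simp
  show "?d' \<le> 2 * ?d"
    using diameter_entries_le[OF \<rho>] small(2) d by simp
  have "x \<in> convex hull (entries zs)"
    using \<mu> d by (intro hull_perturb[OF hull small(1) _ \<rho>]) simp
  moreover
  have "\<bar>Psi_eta \<alpha> zs $ k $ j - Psi_eta \<alpha> xs $ k $ j\<bar> \<le> real l * (4 * \<rho> / ?d)" for k j
  proof -
    have "\<bar>Psi_eta \<alpha> zs $ k $ j - Psi_eta \<alpha> xs $ k $ j\<bar> \<le> real l * norm (eta zs (zs $ k) - eta xs (xs $ k))"
      unfolding Psi_eta_def Psi_def using bij_betw_imp_surj_on[OF \<alpha>]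
      by (auto intro!: psi_diff_le norm_eta_hull_le d d' hull_inc simp: entries_def)
    also have "\<dots> \<le> real l * (4 * \<rho> / ?d)"
      by (intro mult_left_mono norm_eta_diff_le \<rho> d d') simp
    finally show ?thesis .
  qed
  note inv_opnorm_perturb[OF inv this]
  moreover have "s * (real CARD('N) * real CARD('N) * (real l * (4 * \<rho> / ?d))) \<le> 1 / 2"
    using small(3) d by (simp add: field_simps power2_eq_square)
  ultimately show "zs \<in> H_set \<alpha> (2 * s) 0 Z x"
    using zs d' by (simp add: H_set_def ch_mu_def)
qed

lemma F_class_lipschitz:
  assumes f: "f \<in> F_class b Ls" and Ls: "\<And>k. k \<le> b \<Longrightarrow> Ls k \<ge> 0" and b: "b \<ge> 1"
  shows "norm (f x - f y) \<le> Ls 1 * norm (x - y)"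
proof (rule differentiable_bound[of UNIV])
  show "(f has_derivative (\<lambda>v. iter_deriv f [v] z)) (at z within UNIV)" for z
  proof -
    have "iter_deriv f [] = f" by (rule ext) simp
    then show ?thesis
      using iter_deriv_has_derivative[OF F_class_times_cont_diff[OF f], of "[]" z] b by simp
  qed
  show "onorm (\<lambda>v. iter_deriv f [v] z) \<le> Ls 1" for z
    using F_class_norm_iter_deriv[OF f Ls, of "[_]" z] b by (intro onorm_le) simp
qed auto

section \<open>Deterministic error bound for the estimator\<close>

text \<open>The tuple chosen by the estimator may be far from the one that witnesses membership in
  \<open>G_set\<close>; the two are compared through their objectives only.\<close>

lemma fhat_error:
  fixes \<alpha> :: "'N::finite \<Rightarrow> 'd::finite \<Rightarrow> nat" and f :: "real^'d \<Rightarrow> real^'d"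
  assumes \<alpha>: "bij_betw \<alpha> UNIV (multi_indices l)" and b: "b = Suc l"
    and f: "f \<in> F_class b Ls" and Ls: "\<And>k. k \<le> b \<Longrightarrow> Ls k \<ge> 0"
    and D: "D > 0" and \<mu>: "\<mu> \<ge> 0" and s: "s \<ge> 0"
    and x: "x \<in> G_set \<alpha> D \<mu> \<delta> s (u ` {0..T})"
    and uh: "\<And>\<tau>. \<tau> \<in> {0..T} \<Longrightarrow> norm (uh \<tau> - u \<tau>) \<le> \<rho>"
    and duh: "\<And>\<tau>. \<tau> \<in> {0..T} \<Longrightarrow> norm (duh \<tau> - f (u \<tau>)) \<le> \<theta>"
    and small: "D * \<rho> \<le> \<mu> * \<delta>" "4 * D * \<rho> \<le> \<delta>" "8 * s * real CARD('N) ^ 2 * real l * D * \<rho> \<le> \<delta>"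
    and chi: "chi_meaningful \<alpha> l s (uh ` {0..T}) x"
    and y: "is_fhat \<alpha> l s T uh duh x y"
  shows "norm (y - f x) \<le> real CARD('d) * real CARD('N) ^ 2 *
    (2 * s * (\<theta> + Ls 1 * \<rho>) + 4 * s * Ls b * (2 * D * \<delta>) ^ b)"
proof -
  obtain xs where xs: "xs \<in> H_set \<alpha> s \<mu> (u ` {0..T}) x"
      "\<delta> / D \<le> diameter (entries xs)" "diameter (entries xs) \<le> D * \<delta>"
    using x by (auto simp: G_set_def)
  then have "xs $ k \<in> u ` {0..T}" for k
    by (auto simp: H_set_def entries_def)
  then have "\<exists>\<tau>. \<tau> \<in> {0..T} \<and> xs $ k = u \<tau>" for k
    by blast
  then obtain \<sigma> where \<sigma>: "\<And>k. \<sigma> k \<in> {0..T}" "\<And>k. xs $ k = u (\<sigma> k)"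
    by metis
  \<comment> \<open>The estimated trajectory at the times of the true tuple provides a competitor
    for the near-minimal tuple.\<close>
  define zs :: "real^'d^'N" where "zs = (\<chi> k. uh (\<sigma> k))"
  let ?H = "H_set \<alpha> (2 * s) 0 (uh ` {0..T}) x"
  have zs: "zs \<in> ?H" "diameter (entries zs) \<le> 2 * diameter (entries xs)"
  proof (atomize (full), intro conjI, goal_cases)
    have *: "norm (zs $ k - xs $ k) \<le> \<rho>" for k
      using uh[OF \<sigma>(1)] by (simp add: zs_def \<sigma>(2))
    have **: "entries zs \<subseteq> uh ` {0..T}"
      using \<sigma> by (auto simp: entries_def zs_def)
    \<comment> \<open>The diameter is only known to be at least \<open>\<delta> / D\<close>, which
      is why the smallness hypotheses carry a factor \<open>D\<close>.\<close>
    have d: "\<delta> \<le> D * diameter (entries xs)"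
      using xs(2) D by (simp add: field_simps)
    have "D * \<rho> \<le> D * (\<mu> * diameter (entries xs))"
      using small(1) mult_left_mono[OF d \<mu>] by (simp add: mult_ac)
    moreover have "D * (4 * \<rho>) \<le> D * diameter (entries xs)"
      using small(2) d by simp
    moreover have "D * (8 * s * real CARD('N) ^ 2 * real l * \<rho>) \<le> D * diameter (entries xs)"
      using small(3) d by (simp add: mult_ac)
    ultimately have sm: "\<rho> \<le> \<mu> * diameter (entries xs)" "4 * \<rho> \<le> diameter (entries xs)"
      "8 * s * real CARD('N) ^ 2 * real l * \<rho> \<le> diameter (entries xs)"
      using D by simp_all
    case 1 show ?case by (rule H_set_perturb(1)[OF \<alpha> \<mu> xs(1) ** * sm])
    case 2 show ?case by (rule H_set_perturb(2)[OF \<alpha> \<mu> xs(1) ** * sm])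
  qed
  \<comment> \<open>Since \<open>zs\<close> is admissible, \<open>chi_meaningful\<close> provides a
    choice of \<open>\<chi>\<close>, and the value \<open>y\<close> is not a fallback.\<close>
  then obtain x0 \<tau> where x0: "is_chi \<alpha> l s (uh ` {0..T}) x x0"
      "\<And>k. \<tau> k \<in> {0..T}" "\<And>k. x0 $ k = uh (\<tau> k)" "y = interpolant \<alpha> x0 (\<chi> k. duh (\<tau> k)) x"
    using chi y by (auto simp: chi_meaningful_def is_fhat_def)
  let ?I = "inv_opnorm (Psi_eta \<alpha> x0)" and ?d0 = "diameter (entries x0)"
  have H0: "x0 \<in> ?H" and I0: "?I \<le> 2 * s"
    using x0(1) by (auto simp: is_chi_def H_set_def)
  have "diameter (entries zs) \<ge> 0"
    using zs(1) by (simp add: H_set_def)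
  \<comment> \<open>Near-minimality costs a factor 2, the condition number of \<open>zs\<close> is
    at most \<open>2 * s\<close> and its diameter at most \<open>2 * D * \<delta>\<close>.\<close>
  have "objective \<alpha> l x0 \<le> 2 * (INF xs\<in>?H. objective \<alpha> l xs)"
    using x0(1) by (simp add: is_chi_def)
  also have "(INF xs\<in>?H. objective \<alpha> l xs) \<le> objective \<alpha> l zs"
    by (intro cINF_lower zs bdd_belowI2[of _ 0]) (use objective_pos less_imp_le in blast)
  also have "objective \<alpha> l zs \<le> 2 * s * (2 * D * \<delta>) ^ b"
    unfolding objective_def using zs xs(3) s \<open>diameter (entries zs) \<ge> 0\<close>
    by (intro mult_mono) (auto simp: H_set_def b simp del: power_Suc intro!: power_mono)
  finally have obj: "?I * ?d0 ^ b \<le> 4 * s * (2 * D * \<delta>) ^ b"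
    by (simp add: objective_def b)
  \<comment> \<open>The points of \<open>x0\<close> lie on the estimated trajectory, while
    \<open>duh\<close> approximates \<open>f\<close> along the true one; the Lipschitz bound on
    \<open>f\<close> bridges the gap.\<close>
  have E: "norm ((\<chi> k. duh (\<tau> k)) $ k - f (x0 $ k)) \<le> \<theta> + Ls 1 * \<rho>" for k
  proof -
    have "norm (f (u (\<tau> k)) - f (uh (\<tau> k))) \<le> Ls 1 * norm (u (\<tau> k) - uh (\<tau> k))"
      using b by (intro F_class_lipschitz[OF f Ls]) auto
    also have "\<dots> \<le> Ls 1 * \<rho>"
      using uh[OF x0(2)[of k]] Ls[of 1] b by (intro mult_left_mono) (auto simp: norm_minus_commute)
    finally show ?thesis
      using duh[OF x0(2)[of k]] norm_triangle_ineq[of "duh (\<tau> k) - f (u (\<tau> k))" "f (u (\<tau> k)) - f (uh (\<tau> k))"]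
      by (simp add: x0(3))
  qed
  have E0: "\<theta> + Ls 1 * \<rho> \<ge> 0"
    using E order_trans norm_ge_zero by blast
  have "norm (y - f x) \<le> real CARD('d) * real CARD('N) ^ 2 * (?I * (\<theta> + Ls 1 * \<rho> + Ls b * ?d0 ^ b))"
    unfolding x0(4) by (rule interpolation_error[OF \<alpha> b f Ls H0 E])
  \<comment> \<open>In front of the data error the condition number is replaced by its bound; in
    front of the power of the diameter only the product is controlled, through
    \<open>obj\<close>.\<close>
  also have "?I * (\<theta> + Ls 1 * \<rho> + Ls b * ?d0 ^ b) \<le>
      2 * s * (\<theta> + Ls 1 * \<rho>) + 4 * s * Ls b * (2 * D * \<delta>) ^ b"
    using mult_right_mono[OF I0 E0] mult_left_mono[OF obj, of "Ls b"] Ls[of b]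
    by (simp add: distrib_left mult_ac)
  finally show ?thesis
    by (simp add: mult_left_mono)
qed

text \<open>The constants are obtained before \<open>f\<close>, the trajectory and
  \<open>\<delta>\<close> are given, so they can be used uniformly in \<open>n\<close>.\<close>

lemma fhat_error_squared:
  fixes \<alpha> :: "'N::finite \<Rightarrow> 'd::finite \<Rightarrow> nat"
  assumes \<alpha>: "bij_betw \<alpha> UNIV (multi_indices l)" and b: "b = Suc l"
    and Ls: "\<And>k. k \<le> b \<Longrightarrow> Ls k > 0"
    and D: "D > 0" and \<mu>: "\<mu> > 0" and s: "s > 0" and B: "B > 0" and K: "K > 0"
  obtains c C where "c > 0" "C > 0"
    "\<And>(f :: real^'d \<Rightarrow> real^'d) u T uh duh \<delta> \<gamma> \<theta> x y. \<lbrakk>f \<in> F_class b Ls; x \<in> G_set \<alpha> D \<mu> \<delta> s (u ` {0..T});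
      \<And>\<tau>. \<tau> \<in> {0..T} \<Longrightarrow> norm (uh \<tau> - u \<tau>) \<le> B * \<gamma>;
      \<And>\<tau>. \<tau> \<in> {0..T} \<Longrightarrow> norm (duh \<tau> - f (u \<tau>)) \<le> B * \<theta>;
      0 \<le> \<gamma>; \<gamma> \<le> c * \<delta>; \<gamma> \<le> K * \<theta>;
      chi_meaningful \<alpha> l s (uh ` {0..T}) x; is_fhat \<alpha> l s T uh duh x y\<rbrakk>
      \<Longrightarrow> (norm (y - f x))\<^sup>2 \<le> C * (\<delta> ^ (2 * b) + \<theta>\<^sup>2)"
proof
  \<comment> \<open>The summands of \<open>?M\<close> are the factors in the three smallness
    conditions of \<open>fhat_error\<close>, so \<open>\<gamma> \<le> c * \<delta>\<close> implies
    all of them.\<close>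
  let ?M = "1 / \<mu> + 4 + 8 * s * real CARD('N) ^ 2 * real l"
  define c where "c = 1 / (B * D * ?M)"
  have M: "?M > 0" "?M \<ge> 1 / \<mu>" "?M \<ge> 4" "?M \<ge> 8 * s * real CARD('N) ^ 2 * real l"
    using \<mu> s by (auto simp: add_pos_nonneg)
  show "c > 0"
    unfolding c_def using B D M by simp
  \<comment> \<open>The factor \<open>1 + Ls 1 * K\<close> merges the error of the trajectory into
    that of its derivative by means of \<open>\<gamma> \<le> K * \<theta>\<close>.\<close>
  define A where "A = real CARD('d) * real CARD('N) ^ 2 *
    (2 * s * B * (1 + Ls 1 * K) + 4 * s * Ls b * (2 * D) ^ b)"
  have A: "A > 0"
    unfolding A_def using s B K D Ls[of 1] Ls[of b] b
    by (intro mult_pos_pos add_pos_pos zero_less_power) auto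
  then show "2 * A\<^sup>2 > 0" by simp
  fix f :: "real^'d \<Rightarrow> real^'d" and u T uh duh \<delta> \<gamma> \<theta> x y
  assume f: "f \<in> F_class b Ls" and x: "x \<in> G_set \<alpha> D \<mu> \<delta> s (u ` {0..T})"
    and uh: "\<And>\<tau>. \<tau> \<in> {0..T} \<Longrightarrow> norm (uh \<tau> - u \<tau>) \<le> B * \<gamma>"
    and duh: "\<And>\<tau>. \<tau> \<in> {0..T} \<Longrightarrow> norm (duh \<tau> - f (u \<tau>)) \<le> B * \<theta>"
    and \<gamma>: "0 \<le> \<gamma>" "\<gamma> \<le> c * \<delta>" "\<gamma> \<le> K * \<theta>"
    and chi: "chi_meaningful \<alpha> l s (uh ` {0..T}) x" "is_fhat \<alpha> l s T uh duh x y"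
  have \<delta>: "\<delta> \<ge> 0"
    using \<gamma>(1,2) \<open>c > 0\<close> by (metis order_trans zero_le_mult_iff not_less)
  have \<theta>: "\<theta> \<ge> 0"
    using \<gamma>(1,3) K by (metis order_trans zero_le_mult_iff not_less)
  have "(B * D * ?M) * \<gamma> \<le> (B * D * ?M) * (c * \<delta>)"
    using \<gamma>(2) B D M by (intro mult_left_mono) auto
  also have "\<dots> = \<delta>"
    using B D M by (simp add: c_def)
  finally have *: "?M * (D * (B * \<gamma>)) \<le> \<delta>"
    by (simp add: mult_ac)
  have **: "r * (D * (B * \<gamma>)) \<le> \<delta>" if "r \<le> ?M" for r
    using B D \<gamma>(1) by (intro order_trans[OF mult_right_mono[OF that] *]) simp
  have "norm (y - f x) \<le> real CARD('d) * real CARD('N) ^ 2 *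
    (2 * s * (B * \<theta> + Ls 1 * (B * \<gamma>)) + 4 * s * Ls b * (2 * D * \<delta>) ^ b)"
  proof (rule fhat_error[OF \<alpha> b f _ D _ _ x uh duh _ _ _ chi])
    show "D * (B * \<gamma>) \<le> \<mu> * \<delta>"
      using **[OF M(2)] \<mu> by (simp add: field_simps)
    show "4 * D * (B * \<gamma>) \<le> \<delta>"
      using **[OF M(3)] by (simp add: mult_ac)
    show "8 * s * real CARD('N) ^ 2 * real l * D * (B * \<gamma>) \<le> \<delta>"
      using **[OF M(4)] by (simp only: mult_ac)
  qed (use Ls \<mu> s in \<open>auto simp: less_imp_le\<close>)
  also have "\<dots> \<le> real CARD('d) * real CARD('N) ^ 2 *
    ((2 * s * B * (1 + Ls 1 * K)) * (\<delta> ^ b + \<theta>) + (4 * s * Ls b * (2 * D) ^ b) * (\<delta> ^ b + \<theta>))"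
  proof (intro mult_left_mono add_mono)
    have "B * \<theta> + Ls 1 * (B * \<gamma>) \<le> B * \<theta> + Ls 1 * (B * (K * \<theta>))"
      using \<gamma>(3) B Ls[of 1] b by (intro add_left_mono mult_left_mono) auto
    also have "\<dots> = (B * (1 + Ls 1 * K)) * \<theta>"
      by (simp add: algebra_simps)
    also have "\<dots> \<le> (B * (1 + Ls 1 * K)) * (\<delta> ^ b + \<theta>)"
      using B K Ls[of 1] b \<delta> by (intro mult_left_mono) auto
    finally have "(2 * s) * (B * \<theta> + Ls 1 * (B * \<gamma>)) \<le> (2 * s) * ((B * (1 + Ls 1 * K)) * (\<delta> ^ b + \<theta>))"
      using s by (intro mult_left_mono) auto
    then show "2 * s * (B * \<theta> + Ls 1 * (B * \<gamma>)) \<le> (2 * s * B * (1 + Ls 1 * K)) * (\<delta> ^ b + \<theta>)"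
      by (simp add: mult_ac)
    show "4 * s * Ls b * (2 * D * \<delta>) ^ b \<le> (4 * s * Ls b * (2 * D) ^ b) * (\<delta> ^ b + \<theta>)"
      using s Ls[of b] D \<theta> \<delta> by (simp add: power_mult_distrib algebra_simps)
  qed simp
  also have "\<dots> = A * (\<delta> ^ b + \<theta>)"
    by (simp add: A_def algebra_simps)
  finally have "(norm (y - f x))\<^sup>2 \<le> (A * (\<delta> ^ b + \<theta>))\<^sup>2"
    by (intro power_mono) auto
  also have "\<dots> = A\<^sup>2 * (\<delta> ^ b + \<theta>)\<^sup>2"
    by (simp add: power_mult_distrib)
  also have "\<dots> \<le> A\<^sup>2 * (2 * (\<delta> ^ (2 * b) + \<theta>\<^sup>2))"
  proof (rule mult_left_mono)
    have "(\<delta> ^ b + \<theta>)\<^sup>2 \<le> 2 * ((\<delta> ^ b)\<^sup>2 + \<theta>\<^sup>2)"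
      using sum_squares_ge_zero[of "\<delta> ^ b - \<theta>" 0] by (simp add: power2_eq_square algebra_simps)
    then show "(\<delta> ^ b + \<theta>)\<^sup>2 \<le> 2 * (\<delta> ^ (2 * b) + \<theta>\<^sup>2)"
      by (simp add: power_mult[symmetric] mult.commute)
  qed simp
  finally show "(norm (y - f x))\<^sup>2 \<le> 2 * A\<^sup>2 * (\<delta> ^ (2 * b) + \<theta>\<^sup>2)"
    by (simp only: mult_ac)
qed

section \<open>Transfer to the regression model\<close>

lemma noise_measurable:
  "noise M n \<sigma> \<xi> \<Longrightarrow> i \<in> {1..n} \<Longrightarrow> \<xi> i \<in> borel_measurable M"
  unfolding noise_def by (blast intro: borel_measurable_integrable)

lemma data_measurable:
  assumes "\<And>i. i \<in> {1..n} \<Longrightarrow> \<xi> i \<in> borel_measurable M"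
  shows "(\<lambda>\<omega>. data n ts g (\<lambda>i. \<xi> i \<omega>)) \<in> M \<rightarrow>\<^sub>M data_space n"
  unfolding data_def data_space_def
  by (intro measurable_restrict measurable_Pair borel_measurable_add) (auto simp: assms)

text \<open>\<^const>\<open>regression_model\<close> only admits noise on the sample space \<open>nat \<Rightarrow> real^'d\<close>, so the noise is
  replaced by its joint law with the coordinate projections.\<close>

lemma noise_joint_law:
  fixes \<xi> :: "nat \<Rightarrow> 'w \<Rightarrow> real^'d"
  assumes noise: "noise M n \<sigma> \<xi>" and n: "n \<ge> 1"
  defines "M' \<equiv> distr M (PiM {1..n} (\<lambda>_. borel)) (\<lambda>\<omega>. \<lambda>i\<in>{1..n}. \<xi> i \<omega>)"
  shows "noise M' n \<sigma> (\<lambda>i \<omega>. \<omega> i)"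
    "distr M' (data_space n) (\<lambda>\<omega>. data n ts g (\<lambda>i. \<omega> i)) =
      distr M (data_space n) (\<lambda>\<omega>. data n ts g (\<lambda>i. \<xi> i \<omega>))"
proof -
  let ?I = "{1..n}"
  let ?X = "\<lambda>\<omega>. \<lambda>i\<in>?I. \<xi> i \<omega>"
  interpret prob_space M
    using noise by (simp add: noise_def)
  have meas: "\<xi> i \<in> borel_measurable M" if "i \<in> ?I" for i
    using noise_measurable[OF noise that] .
  have X: "?X \<in> M \<rightarrow>\<^sub>M PiM ?I (\<lambda>_. borel)"
    by (intro measurable_restrict meas)
  interpret M': prob_space M'
    unfolding M'_def by (rule prob_space_distr[OF X])
  have proj: "(\<lambda>\<omega>. \<omega> i) \<in> PiM ?I (\<lambda>_. borel) \<rightarrow>\<^sub>M (borel :: (real^'d) measure)" if "i \<in> ?I" for i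
    using that by (rule measurable_component_singleton)
  have proj': "(\<lambda>\<omega>. \<omega> i) \<in> borel_measurable M'" if "i \<in> ?I" for i
    using proj[OF that] by (simp add: M'_def)
  have law: "distr M' borel (\<lambda>\<omega>. \<omega> i) = distr M borel (\<xi> i)" if "i \<in> ?I" for i
    unfolding M'_def using that
    by (subst distr_distr[OF proj[OF that] X]) (auto intro!: distr_cong)
  have "M'.indep_vars (\<lambda>_. borel) (\<lambda>i \<omega>. \<omega> i) ?I"
  proof (subst M'.indep_vars_iff_distr_eq_PiM')
    \<comment> \<open>The space of \<open>M'\<close> consists of extensional functions, on which
      restriction is the identity. The joint law of the projections is thus \<open>M'\<close>
      itself, and independence says that it is the product of its marginals.\<close>
    have "distr M' (PiM ?I (\<lambda>_. borel)) (\<lambda>x. \<lambda>i\<in>?I. x i) = distr M' M' (\<lambda>x. x)"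
      by (rule distr_cong) (auto simp: M'_def space_PiM PiE_restrict)
    also have "\<dots> = M'"
      by (rule distr_id)
    also have "\<dots> = PiM ?I (\<lambda>i. distr M borel (\<xi> i))"
      using noise n unfolding M'_def noise_def
      by (subst indep_vars_iff_distr_eq_PiM'[symmetric]) (auto simp: meas)
    also have "\<dots> = PiM ?I (\<lambda>i. distr M' borel (\<lambda>\<omega>. \<omega> i))"
      by (rule PiM_cong) (simp_all add: law)
    finally show "distr M' (PiM ?I (\<lambda>_. borel)) (\<lambda>x. \<lambda>i\<in>?I. x i) =
        PiM ?I (\<lambda>i. distr M' borel (\<lambda>\<omega>. \<omega> i))" .
  qed (use n proj' in auto)
  moreover have "integrable M' (\<lambda>\<omega>. \<omega> i)" "(\<integral>\<omega>. \<omega> i \<partial>M') = 0"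
    "(\<integral>\<^sup>+\<omega>. ennreal ((norm (\<omega> i))\<^sup>2) \<partial>M') \<le> ennreal (\<sigma>\<^sup>2)" if i: "i \<in> ?I" for i
  proof -
    have ni: "integrable M (\<xi> i)" "(\<integral>\<omega>. \<xi> i \<omega> \<partial>M) = 0"
      "(\<integral>\<^sup>+\<omega>. ennreal ((norm (\<xi> i \<omega>))\<^sup>2) \<partial>M) \<le> ennreal (\<sigma>\<^sup>2)"
      using noise i by (auto simp: noise_def)
    have eq: "(\<lambda>\<omega>. ?X \<omega> i) = \<xi> i"
      using i by auto
    show "integrable M' (\<lambda>\<omega>. \<omega> i)"
      unfolding M'_def using ni(1) i by (subst integrable_distr_eq[OF X proj[OF i]]) simp
    show "(\<integral>\<omega>. \<omega> i \<partial>M') = 0"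
      unfolding M'_def using ni(2) i by (subst integral_distr[OF X proj[OF i]]) simp
    show "(\<integral>\<^sup>+\<omega>. ennreal ((norm (\<omega> i))\<^sup>2) \<partial>M') \<le> ennreal (\<sigma>\<^sup>2)"
      unfolding M'_def using ni(3) i proj[OF i] by (subst nn_integral_distr[OF X]) simp_all
  qed
  ultimately show "noise M' n \<sigma> (\<lambda>i \<omega>. \<omega> i)"
    by (simp add: noise_def M'.prob_space_axioms)
  have dm: "(\<lambda>\<omega>. data n ts g (\<lambda>i. \<omega> i)) \<in> PiM ?I (\<lambda>_. borel) \<rightarrow>\<^sub>M data_space n"
    by (intro data_measurable proj)
  show "distr M' (data_space n) (\<lambda>\<omega>. data n ts g (\<lambda>i. \<omega> i)) =
      distr M (data_space n) (\<lambda>\<omega>. data n ts g (\<lambda>i. \<xi> i \<omega>))"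
    unfolding M'_def distr_distr[OF dm X] by (intro distr_cong) (auto simp: data_def)
qed

section \<open>Boundedness in probability\<close>

text \<open>The covering sets are pulled back along \<open>F n\<close>, which preserves their
  probability. As \<open>F n\<close> is controlled from index 1 on, the threshold becomes
  \<open>max n0 1\<close>.\<close>

lemma bounded_in_prob_distr:
  assumes F: "\<And>n. n \<ge> 1 \<Longrightarrow> F n \<in> P n \<rightarrow>\<^sub>M S n"
    and bd: "bounded_in_prob (\<lambda>n. distr (P n) (S n) (F n)) X a"
  shows "bounded_in_prob P (\<lambda>n \<omega>. X n (F n \<omega>)) a"
  unfolding bounded_in_prob_def
proof (intro allI impI)
  fix e :: real assume "e > 0"
  obtain B n0 where "B > 0" and B: "\<And>n. n \<ge> n0 \<Longrightarrow> \<exists>A\<in>sets (distr (P n) (S n) (F n)).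
      {z \<in> space (distr (P n) (S n) (F n)). X n z / a n > ennreal B} \<subseteq> A \<and>
      measure (distr (P n) (S n) (F n)) A < e"
    using bd[unfolded bounded_in_prob_def, rule_format, OF \<open>e > 0\<close>] by blast
  have "\<exists>A\<in>sets (P n). {\<omega> \<in> space (P n). X n (F n \<omega>) / a n > ennreal B} \<subseteq> A \<and> measure (P n) A < e"
    if n: "n \<ge> max n0 1" for n
  proof -
    obtain A where A: "A \<in> sets (S n)" "{z \<in> space (S n). X n z / a n > ennreal B} \<subseteq> A"
        "measure (distr (P n) (S n) (F n)) A < e"
      using B[of n] n by auto
    have Fn: "F n \<in> P n \<rightarrow>\<^sub>M S n" using F n by simp
    show ?thesis
    proof (intro bexI conjI)
      show "F n -` A \<inter> space (P n) \<in> sets (P n)"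
        using Fn A(1) by (rule measurable_sets)
      show "measure (P n) (F n -` A \<inter> space (P n)) < e"
        using A(3) by (simp add: measure_distr[OF Fn A(1)])
      show "{\<omega> \<in> space (P n). X n (F n \<omega>) / a n > ennreal B} \<subseteq> F n -` A \<inter> space (P n)"
        using A(2) measurable_space[OF Fn] by auto
    qed
  qed
  then show "\<exists>B>0. \<exists>n0. \<forall>n\<ge>n0. \<exists>A\<in>sets (P n).
      {\<omega> \<in> space (P n). X n (F n \<omega>) / a n > ennreal B} \<subseteq> A \<and> measure (P n) A < e"
    using \<open>B > 0\<close> by blast
qed

text \<open>A union bound: each exceptional set has probability below \<open>e / 2\<close>, and
  outside both the bound on \<open>X\<close> is deterministic. The two bounds are first enlarged to
  a common \<open>B\<close>.\<close>

lemma bounded_in_prob_combine: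
  assumes P: "\<And>n. n \<ge> 1 \<Longrightarrow> prob_space (P n)"
    and X1: "bounded_in_prob P X1 a1" and X2: "bounded_in_prob P X2 a2"
    and X: "\<And>B. B > 0 \<Longrightarrow> \<exists>C>0. eventually (\<lambda>n. \<forall>\<omega>\<in>space (P n).
      X1 n \<omega> / a1 n \<le> ennreal B \<longrightarrow> X2 n \<omega> / a2 n \<le> ennreal B \<longrightarrow> X n \<omega> / a n \<le> ennreal C) sequentially"
  shows "bounded_in_prob P X a"
  unfolding bounded_in_prob_def
proof (intro allI impI)
  fix e :: real assume "e > 0"
  then have e: "e / 2 > 0" by simp
  obtain B1 n1 where B1: "B1 > 0" "\<And>n. n \<ge> n1 \<Longrightarrow> \<exists>A\<in>sets (P n).
      {\<omega> \<in> space (P n). X1 n \<omega> / a1 n > ennreal B1} \<subseteq> A \<and> measure (P n) A < e / 2"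
    using X1[unfolded bounded_in_prob_def, rule_format, OF e] by blast
  obtain B2 n2 where B2: "B2 > 0" "\<And>n. n \<ge> n2 \<Longrightarrow> \<exists>A\<in>sets (P n).
      {\<omega> \<in> space (P n). X2 n \<omega> / a2 n > ennreal B2} \<subseteq> A \<and> measure (P n) A < e / 2"
    using X2[unfolded bounded_in_prob_def, rule_format, OF e] by blast
  have le: "ennreal B1 \<le> ennreal (max B1 B2)" "ennreal B2 \<le> ennreal (max B1 B2)"
    by (auto intro: ennreal_leI)
  have "max B1 B2 > 0" using B1 by simp
  from X[OF this] obtain C n3 where C: "C > 0" "\<And>n \<omega>. n \<ge> n3 \<Longrightarrow> \<omega> \<in> space (P n) \<Longrightarrow>
      X1 n \<omega> / a1 n \<le> ennreal (max B1 B2) \<Longrightarrow> X2 n \<omega> / a2 n \<le> ennreal (max B1 B2) \<Longrightarrow>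
      X n \<omega> / a n \<le> ennreal C"
    unfolding eventually_sequentially by blast
  have "\<exists>A\<in>sets (P n). {\<omega> \<in> space (P n). X n \<omega> / a n > ennreal C} \<subseteq> A \<and> measure (P n) A < e"
    if "n \<ge> max (max n1 n2) (max n3 1)" for n
  proof -
    from that have n: "n \<ge> n1" "n \<ge> n2" "n \<ge> n3" "n \<ge> 1" by auto
    interpret prob_space "P n" using P[OF n(4)] .
    obtain A1 where A1: "A1 \<in> sets (P n)" "{\<omega> \<in> space (P n). X1 n \<omega> / a1 n > ennreal B1} \<subseteq> A1"
        "prob A1 < e / 2"
      using B1(2)[OF n(1)] by blast
    obtain A2 where A2: "A2 \<in> sets (P n)" "{\<omega> \<in> space (P n). X2 n \<omega> / a2 n > ennreal B2} \<subseteq> A2"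
        "prob A2 < e / 2"
      using B2(2)[OF n(2)] by blast
    show ?thesis
    proof (intro bexI conjI)
      show "A1 \<union> A2 \<in> sets (P n)" using A1 A2 by simp
      show "prob (A1 \<union> A2) < e"
        using measure_Un_le[OF A1(1) A2(1)] A1(3) A2(3) by simp
      show "{\<omega> \<in> space (P n). X n \<omega> / a n > ennreal C} \<subseteq> A1 \<union> A2"
      proof (rule subsetI, rule ccontr)
        fix \<omega> assume \<omega>: "\<omega> \<in> {\<omega> \<in> space (P n). X n \<omega> / a n > ennreal C}" "\<omega> \<notin> A1 \<union> A2"
        then have "X1 n \<omega> / a1 n \<le> ennreal B1" "X2 n \<omega> / a2 n \<le> ennreal B2"
          using A1(2) A2(2) by (auto simp: not_less[symmetric])
        then have "X n \<omega> / a n \<le> ennreal C"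
          using \<omega>(1) le by (intro C(2)[OF n(3)]) (auto intro: order_trans)
        then show False using \<omega>(1) by auto
      qed
    qed
  qed
  then show "\<exists>B>0. \<exists>n0. \<forall>n\<ge>n0. \<exists>A\<in>sets (P n).
      {\<omega> \<in> space (P n). X n \<omega> / a n > ennreal B} \<subseteq> A \<and> measure (P n) A < e"
    using C(1) by blast
qed

lemma SUP_ennreal_divide_leD:
  assumes "(SUP \<tau>\<in>A. ennreal (h \<tau>)) / ennreal r \<le> ennreal B" and "\<tau> \<in> A" "r > 0" "B > 0" "h \<tau> \<ge> 0"
  shows "h \<tau> \<le> B * r"
proof -
  have "ennreal (h \<tau>) / ennreal r \<le> (SUP \<tau>\<in>A. ennreal (h \<tau>)) / ennreal r"
    using assms(2) by (intro divide_right_mono_ennreal SUP_upper)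
  also note assms(1)
  finally show ?thesis
    using assms(3-) by (simp add: divide_ennreal ennreal_le_iff pos_divide_le_eq)
qed

lemma asymp_prec_eventually:
  assumes "asymp_prec a b" "c > 0"
  shows "eventually (\<lambda>n. a n / b n < ennreal c) sequentially"
  using assms unfolding asymp_prec_def by (intro Limsup_lessD) simp

lemma asymp_preceq_eventually:
  assumes "asymp_preceq a b"
  obtains K where "K > 0" "eventually (\<lambda>n. a n / b n < ennreal K) sequentially"
proof -
  obtain K where "limsup (\<lambda>n. a n / b n) < ennreal K" "K \<ge> 0"
    using assms unfolding asymp_preceq_def
    by (metis dense ennreal_cases infinity_ennreal_def less_irrefl)
  moreover from this have "K > 0"
    by (metis ennreal_0 not_less_zero order_le_less)
  ultimately show ?thesis
    using that Limsup_lessD by blast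
qed

text \<open>The regression bounds are assumed along sequences of models because
  \<open>fstar\<close>, and with it the regression function, may change with \<open>n\<close>. The
  suprema leave out the points where admissible tuples exist but no choice of \<open>\<chi>\<close>,
  since the estimate is arbitrary there. In the second part \<open>\<delta>\<close> is extended-real
  because possibly no radius is admissible for the cube.\<close>

theorem theorem4p17:
  fixes \<beta> l :: nat
    and \<alpha> :: "'N::finite \<Rightarrow> 'd::finite \<Rightarrow> nat"
    and Ls :: "nat \<Rightarrow> real"
    and \<sigma> s D \<mu> L :: real
    and fstar :: "nat \<Rightarrow> real^'d \<Rightarrow> real^'d"
    and x1 :: "nat \<Rightarrow> real^'d"
    and ustar :: "nat \<Rightarrow> real \<Rightarrow> real^'d"
    and T :: "nat \<Rightarrow> real"
    and t :: "nat \<Rightarrow> nat \<Rightarrow> real"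
    and P :: "nat \<Rightarrow> 'w measure"
    and \<epsilon> :: "nat \<Rightarrow> nat \<Rightarrow> 'w \<Rightarrow> real^'d"
    and Est dEst :: "nat \<Rightarrow> (nat \<Rightarrow> real \<times> (real^'d)) \<Rightarrow> real \<Rightarrow> real^'d"
    and \<Gamma> \<Lambda> :: "nat \<Rightarrow> nat \<Rightarrow> real \<Rightarrow> real \<Rightarrow> real"
    and \<Gamma>n \<Lambda>n :: "nat \<Rightarrow> real"
    and uhat duhat :: "nat \<Rightarrow> 'w \<Rightarrow> real \<Rightarrow> real^'d"
    and fhat :: "nat \<Rightarrow> 'w \<Rightarrow> real^'d \<Rightarrow> real^'d"
  assumes d: "CARD('d) \<ge> 2"
    and \<beta>: "\<beta> \<ge> 2"
    and l: "l = \<beta> - 1"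
    and N: "CARD('N) = (l + CARD('d)) choose CARD('d)"
    and \<alpha>: "bij_betw \<alpha> UNIV (multi_indices l)"
    and Ls: "\<And>k. k \<le> \<beta> \<Longrightarrow> Ls k > 0"
    and \<sigma>: "\<sigma> \<ge> 0"
    and s: "s > 0"
    and D: "D > 1"
    and \<mu>: "0 < \<mu>" "\<mu> < 1 / real CARD('N)"
    and L: "L = fact \<beta> * (MAX k\<in>{0..\<beta>}. Ls k ^ (\<beta> + 1))"
    and fstar: "\<And>n. n \<ge> 1 \<Longrightarrow> fstar n \<in> F_class \<beta> Ls"
    and ustar: "\<And>n. n \<ge> 1 \<Longrightarrow> ode_solution (fstar n) (x1 n) (ustar n)"
    and T_pos: "\<And>n. n \<ge> 1 \<Longrightarrow> T n > 0"
    and t_0: "\<And>n. n \<ge> 1 \<Longrightarrow> t n 0 = 0"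
    and t_mono: "\<And>n i. n \<ge> 1 \<Longrightarrow> i < n \<Longrightarrow> t n i \<le> t n (Suc i)"
    and t_n: "\<And>n. n \<ge> 1 \<Longrightarrow> t n n = T n"
    and noise: "\<And>n. n \<ge> 1 \<Longrightarrow> noise (P n) n \<sigma> (\<epsilon> n)"
    and Est_measurable: "\<And>n \<tau>. n \<ge> 1 \<Longrightarrow> (\<lambda>z. Est n z \<tau>) \<in> data_space n \<rightarrow>\<^sub>M borel"
    and dEst_measurable: "\<And>n \<tau>. n \<ge> 1 \<Longrightarrow> (\<lambda>z. dEst n z \<tau>) \<in> data_space n \<rightarrow>\<^sub>M borel"
    and \<Gamma>n: "\<And>n. \<Gamma>n n = \<Gamma> n (\<beta> + 1) L (T n)"
    and \<Lambda>n: "\<And>n. \<Lambda>n n = \<Lambda> n (\<beta> + 1) L (T n)"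
    and \<Gamma>_pos: "\<And>n. n \<ge> 1 \<Longrightarrow> \<Gamma>n n > 0"
    and \<Lambda>_pos: "\<And>n. n \<ge> 1 \<Longrightarrow> \<Lambda>n n > 0"
    and Est_bound: "\<And>g Q. (\<And>n. n \<ge> 1 \<Longrightarrow> (g n, Q n) \<in> regression_model n (t n) (\<beta> + 1) L \<sigma>) \<Longrightarrow>
      bounded_in_prob Q
        (\<lambda>n z. SUP \<tau>\<in>{0..T n}. ennreal (norm (Est n z \<tau> - g n \<tau>))) (\<lambda>n. ennreal (\<Gamma>n n))"
    and dEst_bound: "\<And>g Q. (\<And>n. n \<ge> 1 \<Longrightarrow> (g n, Q n) \<in> regression_model n (t n) (\<beta> + 1) L \<sigma>) \<Longrightarrow>
      bounded_in_prob Q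
        (\<lambda>n z. SUP \<tau>\<in>{0..T n}. ennreal (norm (dEst n z \<tau> - vector_derivative (g n) (at \<tau>))))
        (\<lambda>n. ennreal (\<Lambda>n n))"
    and uhat: "\<And>n \<omega>. uhat n \<omega> = Est n (data n (t n) (ustar n) (\<lambda>i. \<epsilon> n i \<omega>))"
    and duhat: "\<And>n \<omega>. duhat n \<omega> = dEst n (data n (t n) (ustar n) (\<lambda>i. \<epsilon> n i \<omega>))"
    and fhat: "\<And>n \<omega> x. n \<ge> 1 \<Longrightarrow> \<omega> \<in> space (P n) \<Longrightarrow>
      is_fhat \<alpha> l s (T n) (uhat n \<omega>) (duhat n \<omega>) x (fhat n \<omega> x)"
    and T_prec_n: "asymp_prec (\<lambda>n. ennreal (T n)) (\<lambda>n. ennreal (real n))"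
    and \<Gamma>_prec_1: "asymp_prec (\<lambda>n. ennreal (\<Gamma>n n)) (\<lambda>n. 1)"
    and \<Gamma>_preceq_\<Lambda>: "asymp_preceq (\<lambda>n. ennreal (\<Gamma>n n)) (\<lambda>n. ennreal (\<Lambda>n n))"
    and \<Lambda>_preceq_1: "asymp_preceq (\<lambda>n. ennreal (\<Lambda>n n)) (\<lambda>n. 1)"
  shows "(\<forall>\<delta>. (\<forall>n. \<delta> n \<ge> 0) \<longrightarrow>
            asymp_prec (\<lambda>n. ennreal (\<Gamma>n n)) (\<lambda>n. ennreal (\<delta> n)) \<longrightarrow>
            bounded_in_prob P
              (\<lambda>n \<omega>. SUP x\<in>{x \<in> G_set \<alpha> D \<mu> (\<delta> n) s (ustar n ` {0..T n}).
                             chi_meaningful \<alpha> l s (uhat n \<omega> ` {0..T n}) x}.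
                 ennreal ((norm (fhat n \<omega> x - fstar n x))\<^sup>2))
              (\<lambda>n. ennreal (\<delta> n ^ (2 * \<beta>) + (\<Lambda>n n)\<^sup>2))) \<and>
         (\<forall>\<delta>. (\<forall>n. \<delta> n = delta_NN \<alpha> D \<mu> s (ustar n) (T n) (cbox 0 1)) \<longrightarrow>
            asymp_prec (\<lambda>n. ennreal (\<Gamma>n n)) \<delta> \<longrightarrow>
            bounded_in_prob P
              (\<lambda>n \<omega>. SUP x\<in>{x \<in> cbox 0 1. chi_meaningful \<alpha> l s (uhat n \<omega> ` {0..T n}) x}.
                 ennreal ((norm (fhat n \<omega> x - fstar n x))\<^sup>2))
              (\<lambda>n. \<delta> n ^ (2 * \<beta>) + ennreal ((\<Lambda>n n)\<^sup>2)))"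
proof -
  have b: "\<beta> = Suc l" using \<beta> l by simp
  have Lpos: "0 \<le> Ls k \<and> Ls k \<le> Max (Ls ` {0..\<beta>})" if "k \<le> \<beta>" for k
    using Ls[OF that] that by auto
  \<comment> \<open>\<open>L\<close> contains the maximum of the powers, the regularity lemma the
    power of the maximum; an index \<open>k0\<close> that attains the maximum compares them.\<close>
  have "Max (Ls ` {0..\<beta>}) \<in> Ls ` {0..\<beta>}"
    by (intro Max_in) auto
  then obtain k0 where k0: "k0 \<in> {0..\<beta>}" "Max (Ls ` {0..\<beta>}) = Ls k0"
    by blast
  have "Ls k0 ^ (\<beta> + 1) \<le> (MAX k\<in>{0..\<beta>}. Ls k ^ (\<beta> + 1))"
    using k0(1) by (intro Max_ge) auto
  then have L_ge: "fact \<beta> * Max (Ls ` {0..\<beta>}) ^ Suc \<beta> \<le> L"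
    unfolding k0(2) L by (intro mult_left_mono) auto
  have u_deriv: "(ustar n has_vector_derivative fstar n (ustar n \<tau>)) (at \<tau>)" if "n \<ge> 1" for n \<tau>
    using ustar[OF that] by (simp add: ode_solution_def)
  define Y where "Y n \<omega> = data n (t n) (ustar n) (\<lambda>i. \<epsilon> n i \<omega>)" for n \<omega>
  have Y: "Y n \<in> P n \<rightarrow>\<^sub>M data_space n" if "n \<ge> 1" for n
    unfolding Y_def using noise_measurable[OF noise[OF that]] by (intro data_measurable)
  have model: "(ustar n, distr (P n) (data_space n) (Y n)) \<in> regression_model n (t n) (\<beta> + 1) L \<sigma>"
    if n: "n \<ge> 1" for n
  proof -
    have "ustar n \<in> Sigma_class (\<beta> + 1) L"
      by (rule ode_solution_Sigma_class[OF fstar[OF n] u_deriv[OF n] Lpos L_ge])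
    then show ?thesis
      unfolding regression_model_def Y_def mem_Collect_eq prod.case
      by (intro conjI exI) (assumption, rule noise_joint_law(1)[OF noise[OF n] n],
        rule noise_joint_law(2)[OF noise[OF n] n, symmetric])
  qed
  let ?U = "\<lambda>n \<omega>. SUP \<tau>\<in>{0..T n}. ennreal (norm (uhat n \<omega> \<tau> - ustar n \<tau>))"
  let ?V = "\<lambda>n \<omega>. SUP \<tau>\<in>{0..T n}. ennreal (norm (duhat n \<omega> \<tau> - vector_derivative (ustar n) (at \<tau>)))"
  have U: "bounded_in_prob P ?U (\<lambda>n. ennreal (\<Gamma>n n))"
    using bounded_in_prob_distr[OF Y Est_bound[OF model]] by (simp add: uhat Y_def)
  have V: "bounded_in_prob P ?V (\<lambda>n. ennreal (\<Lambda>n n))"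
    using bounded_in_prob_distr[OF Y dEst_bound[OF model]] by (simp add: duhat Y_def)
  obtain K where K: "K > 0" "eventually (\<lambda>n. ennreal (\<Gamma>n n) / ennreal (\<Lambda>n n) < ennreal K) sequentially"
    using asymp_preceq_eventually[OF \<Gamma>_preceq_\<Lambda>] .
  \<comment> \<open>Both parts are instances. The radius \<open>\<delta>'\<close> is separate from
    \<open>\<delta> n\<close> because the infimum in the second part need not be attained. Only
    positive finite \<open>\<delta> n\<close> require a radius.\<close>
  have main: "bounded_in_prob P
      (\<lambda>n \<omega>. SUP x\<in>{x \<in> S n. chi_meaningful \<alpha> l s (uhat n \<omega> ` {0..T n}) x}.
         ennreal ((norm (fhat n \<omega> x - fstar n x))\<^sup>2))
      (\<lambda>n. \<delta> n ^ (2 * \<beta>) + ennreal ((\<Lambda>n n)\<^sup>2))"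
    if \<delta>: "asymp_prec (\<lambda>n. ennreal (\<Gamma>n n)) \<delta>"
      and S: "\<And>n. n \<ge> 1 \<Longrightarrow> 0 < \<delta> n \<Longrightarrow> \<delta> n < \<infinity> \<Longrightarrow>
        \<exists>\<delta>'\<ge>0. \<delta> n \<le> ennreal \<delta>' \<and> ennreal \<delta>' \<le> 2 * \<delta> n \<and> S n \<subseteq> G_set \<alpha> D \<mu> \<delta>' s (ustar n ` {0..T n})"
    for \<delta> :: "nat \<Rightarrow> ennreal" and S
  proof (rule bounded_in_prob_combine[OF _ U V])
    show "prob_space (P n)" if "n \<ge> 1" for n
      using noise[OF that] by (simp add: noise_def)
    fix B :: real assume B: "B > 0"
    have D0: "D > 0" using D by simp
    \<comment> \<open>\<open>B\<close> bounds both normalised regression errors on the good event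
      and \<open>K\<close> is the ratio bound between \<open>\<Gamma>n\<close> and
      \<open>\<Lambda>n\<close>; \<open>c\<close> and \<open>C\<close> are the same for all
      \<open>n\<close>.\<close>
    obtain c C where c: "c > 0" "C > 0"
      "\<And>(f :: real^'d \<Rightarrow> real^'d) u T uh duh \<delta> \<gamma> \<theta> x y. \<lbrakk>f \<in> F_class \<beta> Ls; x \<in> G_set \<alpha> D \<mu> \<delta> s (u ` {0..T});
        \<And>\<tau>. \<tau> \<in> {0..T} \<Longrightarrow> norm (uh \<tau> - u \<tau>) \<le> B * \<gamma>;
        \<And>\<tau>. \<tau> \<in> {0..T} \<Longrightarrow> norm (duh \<tau> - f (u \<tau>)) \<le> B * \<theta>;
        0 \<le> \<gamma>; \<gamma> \<le> c * \<delta>; \<gamma> \<le> K * \<theta>;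
        chi_meaningful \<alpha> l s (uh ` {0..T}) x; is_fhat \<alpha> l s T uh duh x y\<rbrakk>
        \<Longrightarrow> (norm (y - f x))\<^sup>2 \<le> C * (\<delta> ^ (2 * \<beta>) + \<theta>\<^sup>2)"
      by (rule fhat_error_squared[OF \<alpha> b Ls D0 \<mu>(1) s B K(1)]) blast+
    let ?X = "\<lambda>n \<omega>. SUP x\<in>{x \<in> S n. chi_meaningful \<alpha> l s (uhat n \<omega> ` {0..T n}) x}.
         ennreal ((norm (fhat n \<omega> x - fstar n x))\<^sup>2)"
    let ?a = "\<lambda>n. \<delta> n ^ (2 * \<beta>) + ennreal ((\<Lambda>n n)\<^sup>2)"
    \<comment> \<open>The power of 2 pays for a radius \<open>\<delta>'\<close> of up to
      \<open>2 * \<delta> n\<close>.\<close>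
    let ?C = "C * 2 ^ (2 * \<beta>)"
    have bd: "\<forall>\<omega>\<in>space (P n). ?U n \<omega> / ennreal (\<Gamma>n n) \<le> ennreal B \<longrightarrow> ?V n \<omega> / ennreal (\<Lambda>n n) \<le> ennreal B \<longrightarrow>
        ?X n \<omega> / ?a n \<le> ennreal ?C"
      if n: "n \<ge> 1" and lt: "ennreal (\<Gamma>n n) / \<delta> n < ennreal c" "ennreal (\<Gamma>n n) / ennreal (\<Lambda>n n) < ennreal K" for n
    proof (intro ballI impI)
      fix \<omega> assume \<omega>: "\<omega> \<in> space (P n)" and UV: "?U n \<omega> / ennreal (\<Gamma>n n) \<le> ennreal B"
          "?V n \<omega> / ennreal (\<Lambda>n n) \<le> ennreal B"
      note \<Gamma> = \<Gamma>_pos[OF n] and \<Lambda> = \<Lambda>_pos[OF n]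
      have \<Gamma>\<Lambda>: "\<Gamma>n n \<le> K * \<Lambda>n n"
        using lt(2) \<Gamma> \<Lambda> K(1) by (simp add: divide_ennreal ennreal_less_iff pos_divide_less_eq)
      have uh: "norm (uhat n \<omega> \<tau> - ustar n \<tau>) \<le> B * \<Gamma>n n" if "\<tau> \<in> {0..T n}" for \<tau>
        by (rule SUP_ennreal_divide_leD[OF UV(1) that \<Gamma> B]) simp
      have "norm (duhat n \<omega> \<tau> - vector_derivative (ustar n) (at \<tau>)) \<le> B * \<Lambda>n n" if "\<tau> \<in> {0..T n}" for \<tau>
        by (rule SUP_ennreal_divide_leD[OF UV(2) that \<Lambda> B]) simp
      then have duh: "norm (duhat n \<omega> \<tau> - fstar n (ustar n \<tau>)) \<le> B * \<Lambda>n n" if "\<tau> \<in> {0..T n}" for \<tau>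
        using that vector_derivative_at[OF u_deriv[OF n]] by metis
      show "?X n \<omega> / ?a n \<le> ennreal ?C"
      proof (cases "\<delta> n = \<infinity>")
        \<comment> \<open>An infinite rate makes the quotient 0.\<close>
        case True
        then have "?a n = \<infinity>"
          using \<beta> by (simp add: power_eq_top_ennreal)
        then show ?thesis by simp
      next
        case False
        then obtain r where r: "\<delta> n = ennreal r" "r \<ge> 0"
          by (cases "\<delta> n") auto
        \<comment> \<open>Division of the positive \<open>\<Gamma>n n\<close> by 0 would be
          infinite, contrary to the bound by \<open>c\<close>.\<close>
        have "r > 0"
        proof (rule ccontr)
          assume "\<not> r > 0"
          then have "ennreal (\<Gamma>n n) / \<delta> n = \<infinity>"
            using r \<Gamma> by (simp add: ennreal_divide_zero)
          then show False using lt(1) by simp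
        qed
        then have "\<Gamma>n n \<le> c * r"
          using lt(1) \<Gamma> c(1) r by (simp add: divide_ennreal ennreal_less_iff pos_divide_less_eq)
        obtain \<delta>' where \<delta>': "\<delta>' \<ge> 0" "r \<le> \<delta>'" "\<delta>' \<le> 2 * r"
            "S n \<subseteq> G_set \<alpha> D \<mu> \<delta>' s (ustar n ` {0..T n})"
        proof -
          have "2 * ennreal r = ennreal (2 * r)"
            using r(2) by (simp add: ennreal_mult)
          then show ?thesis
            using S[OF n] \<open>r > 0\<close> r that by auto
        qed
        have \<gamma>: "\<Gamma>n n \<le> c * \<delta>'"
          using order_trans[OF \<open>\<Gamma>n n \<le> c * r\<close> mult_left_mono[OF \<delta>'(2)]] c(1) by simp
        have "?X n \<omega> \<le> ennreal (?C * (r ^ (2 * \<beta>) + (\<Lambda>n n)\<^sup>2))"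
        proof (rule SUP_least)
          fix x assume "x \<in> {x \<in> S n. chi_meaningful \<alpha> l s (uhat n \<omega> ` {0..T n}) x}"
          then have x: "x \<in> G_set \<alpha> D \<mu> \<delta>' s (ustar n ` {0..T n})"
              "chi_meaningful \<alpha> l s (uhat n \<omega> ` {0..T n}) x"
            using \<delta>'(4) by auto
          have "(norm (fhat n \<omega> x - fstar n x))\<^sup>2 \<le> C * (\<delta>' ^ (2 * \<beta>) + (\<Lambda>n n)\<^sup>2)"
            by (rule c(3)[OF fstar[OF n] x(1) uh duh less_imp_le[OF \<Gamma>] \<gamma> \<Gamma>\<Lambda> x(2) fhat[OF n \<omega>]])
          also have "\<dots> \<le> C * (2 ^ (2 * \<beta>) * r ^ (2 * \<beta>) + 2 ^ (2 * \<beta>) * (\<Lambda>n n)\<^sup>2)"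
          proof (intro mult_left_mono add_mono)
            show "\<delta>' ^ (2 * \<beta>) \<le> 2 ^ (2 * \<beta>) * r ^ (2 * \<beta>)"
              using power_mono[OF \<delta>'(3,1)] by (simp add: power_mult_distrib)
            show "(\<Lambda>n n)\<^sup>2 \<le> 2 ^ (2 * \<beta>) * (\<Lambda>n n)\<^sup>2"
              by (simp add: mult_le_cancel_right1)
          qed (use c(2) in simp)
          finally show "ennreal ((norm (fhat n \<omega> x - fstar n x))\<^sup>2) \<le> ennreal (?C * (r ^ (2 * \<beta>) + (\<Lambda>n n)\<^sup>2))"
            by (intro ennreal_leI) (simp add: algebra_simps)
        qed
        also have "ennreal (?C * (r ^ (2 * \<beta>) + (\<Lambda>n n)\<^sup>2)) = ennreal ?C * ?a n"
          using r c(2) by (simp add: ennreal_mult ennreal_power)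
        finally have "?X n \<omega> / ?a n \<le> ennreal ?C * ?a n / ?a n"
          by (rule divide_right_mono_ennreal)
        also have "\<dots> = ennreal ?C"
        proof -
          have a: "?a n = ennreal (r ^ (2 * \<beta>) + (\<Lambda>n n)\<^sup>2)"
            using r by (simp add: ennreal_power)
          have "ennreal k * ennreal q / ennreal q = ennreal k" if "k \<ge> 0" "q > 0" for k q
            using that by (simp add: ennreal_mult[symmetric] divide_ennreal)
          then show ?thesis
            unfolding a using c(2) \<Lambda> r by (simp add: add_nonneg_pos del: ennreal_plus)
        qed
        finally show ?thesis .
      qed
    qed
    have "eventually (\<lambda>n. \<forall>\<omega>\<in>space (P n). ?U n \<omega> / ennreal (\<Gamma>n n) \<le> ennreal B \<longrightarrow>
        ?V n \<omega> / ennreal (\<Lambda>n n) \<le> ennreal B \<longrightarrow> ?X n \<omega> / ?a n \<le> ennreal ?C) sequentially"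
      using eventually_ge_at_top[of 1] asymp_prec_eventually[OF \<delta> c(1)] K(2)
      by eventually_elim (rule bd)
    then show "\<exists>C>0. eventually (\<lambda>n. \<forall>\<omega>\<in>space (P n). ?U n \<omega> / ennreal (\<Gamma>n n) \<le> ennreal B \<longrightarrow>
        ?V n \<omega> / ennreal (\<Lambda>n n) \<le> ennreal B \<longrightarrow> ?X n \<omega> / ?a n \<le> ennreal C) sequentially"
      using c(2) by (intro exI[of _ ?C]) simp
  qed
  show ?thesis
  proof (intro conjI allI impI)
    fix \<delta> :: "nat \<Rightarrow> real"
    assume \<delta>: "\<forall>n. \<delta> n \<ge> 0" "asymp_prec (\<lambda>n. ennreal (\<Gamma>n n)) (\<lambda>n. ennreal (\<delta> n))"
    have "(\<lambda>n. ennreal (\<delta> n ^ (2 * \<beta>) + (\<Lambda>n n)\<^sup>2)) = (\<lambda>n. ennreal (\<delta> n) ^ (2 * \<beta>) + ennreal ((\<Lambda>n n)\<^sup>2))"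
      using \<delta>(1) by (simp add: ennreal_power)
    then show "bounded_in_prob P
        (\<lambda>n \<omega>. SUP x\<in>{x \<in> G_set \<alpha> D \<mu> (\<delta> n) s (ustar n ` {0..T n}).
                       chi_meaningful \<alpha> l s (uhat n \<omega> ` {0..T n}) x}.
           ennreal ((norm (fhat n \<omega> x - fstar n x))\<^sup>2))
        (\<lambda>n. ennreal (\<delta> n ^ (2 * \<beta>) + (\<Lambda>n n)\<^sup>2))"
    proof (simp only:, intro main[OF \<delta>(2)])
      fix n
      have "ennreal (\<delta> n) \<le> 2 * ennreal (\<delta> n)"
        using mult_right_mono[of 1 2 "ennreal (\<delta> n)"] by simp
      then show "\<exists>\<delta>'\<ge>0. ennreal (\<delta> n) \<le> ennreal \<delta>' \<and> ennreal \<delta>' \<le> 2 * ennreal (\<delta> n) \<and>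
          G_set \<alpha> D \<mu> (\<delta> n) s (ustar n ` {0..T n}) \<subseteq> G_set \<alpha> D \<mu> \<delta>' s (ustar n ` {0..T n})"
        using \<delta>(1) by (intro exI[of _ "\<delta> n"]) simp
    qed
  next
    fix \<delta> :: "nat \<Rightarrow> ennreal"
    assume \<delta>: "\<forall>n. \<delta> n = delta_NN \<alpha> D \<mu> s (ustar n) (T n) (cbox 0 1)"
      "asymp_prec (\<lambda>n. ennreal (\<Gamma>n n)) \<delta>"
    show "bounded_in_prob P
        (\<lambda>n \<omega>. SUP x\<in>{x \<in> cbox 0 1. chi_meaningful \<alpha> l s (uhat n \<omega> ` {0..T n}) x}.
           ennreal ((norm (fhat n \<omega> x - fstar n x))\<^sup>2))
        (\<lambda>n. \<delta> n ^ (2 * \<beta>) + ennreal ((\<Lambda>n n)\<^sup>2))"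
    proof (rule main[OF \<delta>(2)])
      fix n
      assume pos: "0 < \<delta> n" "\<delta> n < \<infinity>"
      let ?A = "{ennreal \<delta>' | \<delta>'. \<delta>' \<ge> 0 \<and> cbox 0 1 \<subseteq> G_set \<alpha> D \<mu> \<delta>' s (ustar n ` {0..T n})}"
      have inf: "\<delta> n = Inf ?A"
        using \<delta>(1) by (simp add: delta_NN_def)
      obtain r where r: "\<delta> n = ennreal r" "r > 0"
        using pos by (cases "\<delta> n") auto
      \<comment> \<open>Positivity and finiteness make \<open>2 * \<delta> n\<close> strictly larger
        than the infimum, so some admissible radius lies below it.\<close>
      have "\<delta> n < 2 * \<delta> n"
        using r by (simp add: ennreal_less_iff flip: ennreal_mult' ennreal_numeral)
      then obtain \<delta>' where "\<delta>' \<ge> 0" "cbox 0 1 \<subseteq> G_set \<alpha> D \<mu> \<delta>' s (ustar n ` {0..T n})" "ennreal \<delta>' < 2 * \<delta> n"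
        by (subst (asm) inf) (auto simp: Inf_less_iff)
      moreover from this have "\<delta> n \<le> ennreal \<delta>'"
        unfolding inf by (intro Inf_lower) blast
      ultimately show "\<exists>\<delta>'\<ge>0. \<delta> n \<le> ennreal \<delta>' \<and> ennreal \<delta>' \<le> 2 * \<delta> n \<and>
          cbox 0 1 \<subseteq> G_set \<alpha> D \<mu> \<delta>' s (ustar n ` {0..T n})"
        by (auto intro: less_imp_le)
    qed
  qed
qed

end
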